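(* Let $\omega>0$, let $L>1$ be an integer, and let $\Phi_L=(\varphi_1,\dots,\varphi_L)$ be the functions in $L^2(\mathbb R)$ defined by $\widehat{\varphi_j}(x)=(ix)^{j-1}\chi_{[-\omega,\omega]}(x)$, $j=1,\dots,L$. If $t_o$ is a positive number such that $(L-1)\frac{\pi}{\omega}<t_o\le L\frac{\pi}{\omega}$, then $E_{\Phi_L,t_o}=\{\tau_{nt_o}\varphi_j:n\in\mathbb Z,\ 1\le j\le L\}$ is a frame for $B_\omega$. If $t_o=L\frac{\pi}{\omega}$, then $E_{\Phi_L,t_o}$ is a Riesz basis for $B_\omega$.
   Context: Fourier transform: $\widehat f(\xi)=\frac1{\sqrt{2\pi}}\int f(t)e^{-it\xi}\,dt$. $B_\omega$ is the space of $f\in L^2(\mathbb R)$ whose Fourier transform is supported in $[-\omega,\omega]$. $\tau_af(x)=f(x+a)$; $\chi_{[-\omega,\omega]}$ is the indicator function of $[-\omega,\omega]$. $E_{\Phi_L,t_o}$ is a frame for $B_\omega$ if there are constants $0<A\le B$ with $A\|f\|^2\le\sum_{j=1}^L\sum_{n\in\mathbb Z}|\langle f,\tau_{nt_o}\varphi_j\rangle|^2\le B\|f\|^2$ for all $f\in B_\omega$; equivalently, the synthesis operator $T:\ell^2(\mathbb Z;\mathbb C^L)\to B_\omega$, $Tc=\sum_{j=1}^L\sum_{n}c_j(n)\tau_{nt_o}\varphi_j$, is well defined, continuous and surjective. It is a Riesz basis if it is a frame and $T$ is injective. *)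

theory Defs
  imports "HOL-Analysis.Analysis"
begin

text \<open>Elements of $L^2(\mathbb R)$ are represented by Borel measurable functions; all notions
  below are invariant under changing such a function on a null set.\<close>

definition L2 :: "(real \<Rightarrow> complex) set" where
  "L2 = {f. f \<in> borel_measurable lborel \<and> integrable lborel (\<lambda>x. (cmod (f x))\<^sup>2)}"

definition L2_norm :: "(real \<Rightarrow> complex) \<Rightarrow> real" where
  "L2_norm f = sqrt (LINT x|lborel. (cmod (f x))\<^sup>2)"

definition L2_inner :: "(real \<Rightarrow> complex) \<Rightarrow> (real \<Rightarrow> complex) \<Rightarrow> complex" where
  "L2_inner f g = (LINT x|lborel. f x * cnj (g x))"

text \<open>The nonnegative integral is used here because the Bochner integral of a non-integrable
  function is 0, which would create spurious limits.\<close>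

definition L2_tendsto :: "('a \<Rightarrow> real \<Rightarrow> complex) \<Rightarrow> (real \<Rightarrow> complex) \<Rightarrow> 'a filter \<Rightarrow> bool" where
  "L2_tendsto u f F \<longleftrightarrow>
     ((\<lambda>a. \<integral>\<^sup>+ x. ennreal ((cmod (u a x - f x))\<^sup>2) \<partial>lborel) \<longlongrightarrow> 0) F"

definition fourier_truncated :: "real \<Rightarrow> (real \<Rightarrow> complex) \<Rightarrow> real \<Rightarrow> complex" where
  "fourier_truncated R f \<xi> =
     complex_of_real (1 / sqrt (2 * pi)) *
       (LINT t:{-R..R}|lborel. f t * exp (- (\<i> * complex_of_real (t * \<xi>))))"

text \<open>\<open>has_fourier f g\<close>: $g$ is (a representative of) the Fourier transform of $f \in L^2$. The
  integral need not converge absolutely for such $f$, so the transform is the $L^2$-limit of the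
  transforms of $f\,\chi_{[-R,R]}$ as $R \to \infty$.\<close>

definition has_fourier :: "(real \<Rightarrow> complex) \<Rightarrow> (real \<Rightarrow> complex) \<Rightarrow> bool" where
  "has_fourier f g \<longleftrightarrow> f \<in> L2 \<and> g \<in> L2 \<and> L2_tendsto (\<lambda>R. fourier_truncated R f) g at_top"

definition band_limited :: "real \<Rightarrow> (real \<Rightarrow> complex) set" where
  "band_limited \<omega> =
     {f \<in> L2. \<exists>g. has_fourier f g \<and> (AE \<xi> in lborel. \<xi> \<notin> {-\<omega>..\<omega>} \<longrightarrow> g \<xi> = 0)}"

definition shift :: "real \<Rightarrow> (real \<Rightarrow> complex) \<Rightarrow> real \<Rightarrow> complex" where
  "shift a f x = f (x + a)"

text \<open>Systems of translates are treated as families indexed by $j \in \{1,\dots,L\}$ and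
  $n \in \mathbb Z$; the values of \<open>\<phi> j\<close> and \<open>c j\<close> for other $j$ are irrelevant. Summability is
  demanded explicitly because \<open>infsum\<close> is 0 for non-summable families.\<close>

definition is_frame ::
  "real \<Rightarrow> nat \<Rightarrow> (nat \<Rightarrow> real \<Rightarrow> complex) \<Rightarrow> real \<Rightarrow> bool" where
  "is_frame \<omega> L \<phi> t \<longleftrightarrow>
     (\<forall>j\<in>{1..L}. \<forall>n::int. shift (of_int n * t) (\<phi> j) \<in> band_limited \<omega>) \<and>
     (\<exists>A B. 0 < A \<and> A \<le> B \<and>
       (\<forall>f\<in>band_limited \<omega>.
          (\<forall>j\<in>{1..L}. (\<lambda>n::int. (cmod (L2_inner f (shift (of_int n * t) (\<phi> j))))\<^sup>2)
             summable_on UNIV) \<and>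
          A * (L2_norm f)\<^sup>2
            \<le> (\<Sum>j=1..L. \<Sum>\<^sub>\<infinity>n::int. (cmod (L2_inner f (shift (of_int n * t) (\<phi> j))))\<^sup>2) \<and>
          (\<Sum>j=1..L. \<Sum>\<^sub>\<infinity>n::int. (cmod (L2_inner f (shift (of_int n * t) (\<phi> j))))\<^sup>2)
            \<le> B * (L2_norm f)\<^sup>2))"

definition ell2 :: "nat \<Rightarrow> (nat \<Rightarrow> int \<Rightarrow> complex) set" where
  "ell2 L = {c. \<forall>j\<in>{1..L}. (\<lambda>n. (cmod (c j n))\<^sup>2) summable_on UNIV}"

text \<open>\<open>synthesis \<omega> L \<phi> t c f\<close> is the graph of the synthesis operator: $f \in B_\omega$ and
  $Tc = f$ almost everywhere, the series converging unconditionally in $L^2$.\<close>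

definition synthesis ::
  "real \<Rightarrow> nat \<Rightarrow> (nat \<Rightarrow> real \<Rightarrow> complex) \<Rightarrow> real \<Rightarrow> (nat \<Rightarrow> int \<Rightarrow> complex) \<Rightarrow>
   (real \<Rightarrow> complex) \<Rightarrow> bool" where
  "synthesis \<omega> L \<phi> t c f \<longleftrightarrow>
     f \<in> band_limited \<omega> \<and>
     L2_tendsto (\<lambda>N x. \<Sum>j=1..L. \<Sum>n\<in>N. c j n * shift (of_int n * t) (\<phi> j) x) f
       (finite_subsets_at_top UNIV)"

text \<open>The second conjunct says that $T$ is defined on all of $\ell^2$, so that its injectivity,
  expressed through its graph in the third, is not vacuous.\<close>

definition is_riesz_basis ::
  "real \<Rightarrow> nat \<Rightarrow> (nat \<Rightarrow> real \<Rightarrow> complex) \<Rightarrow> real \<Rightarrow> bool" where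
  "is_riesz_basis \<omega> L \<phi> t \<longleftrightarrow>
     is_frame \<omega> L \<phi> t \<and>
     (\<forall>c\<in>ell2 L. \<exists>f. synthesis \<omega> L \<phi> t c f) \<and>
     (\<forall>c\<in>ell2 L. \<forall>d\<in>ell2 L. \<forall>f.
        synthesis \<omega> L \<phi> t c f \<and> synthesis \<omega> L \<phi> t d f \<longrightarrow> (\<forall>j\<in>{1..L}. c j = d j))"

end

theory Submission
  imports Defs
begin

text \<open>
  On the Fourier side, the translate \<open>\<tau>\<^bsub>nt\<^esub> \<phi>\<^sub>j\<close> becomes
  \<open>e\<^bsup>int\<xi>\<^esup> (i\<xi>)\<^bsup>j-1\<^esup>\<close> on \<open>[-\<omega>, \<omega>]\<close>. Put \<open>p = 2\<pi>/t\<close>. The exponentials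
  \<open>e\<^bsup>int\<xi>\<^esup>\<close> are \<open>p\<close>-periodic, so if \<open>f\<close> has spectrum \<open>g\<close>, the numbers
  \<open>\<langle>f, \<tau>\<^bsub>nt\<^esub> \<phi>\<^sub>j\<rangle>\<close>, with \<open>n\<close> running, are the Fourier coefficients over the single period
  \<open>[-\<omega>, -\<omega> + p)\<close> of the folded function
  \<open>F\<^sub>j(x) = \<Sum>\<^bsub>k<L\<^esub> cnj ((i(x + kp))\<^bsup>j-1\<^esup>) g(x + kp)\<close>.
  The condition \<open>t \<le> L\<pi>/\<omega>\<close> says that \<open>L\<close> periods cover the band, so no values of \<open>g\<close> are lost.
  By Parseval the sum over \<open>n\<close> and \<open>j\<close> of the squared coefficients is
  \<open>p \<integral> \<Sum>\<^sub>j |F\<^sub>j|\<^sup>2\<close>. For fixed \<open>x\<close> the vector \<open>(F\<^sub>j(x))\<close> arises from \<open>(g(x + kp))\<close> by the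
  conjugate of the Vandermonde matrix with the distinct nodes \<open>i(x + kp)\<close>. Since \<open>x\<close> stays in a compact interval,
  this matrix and its inverse (Lagrange interpolation) are bounded uniformly in \<open>x\<close>, and the frame
  inequalities follow because \<open>\<integral> \<Sum>\<^sub>k |g(x + kp)|\<^sup>2 = \<parallel>f\<parallel>\<^sup>2\<close>.

  If \<open>t = L\<pi>/\<omega>\<close>, the \<open>L\<close> periods tile the band exactly. The transposed matrix, without conjugation,
  then takes the trigonometric polynomials \<open>\<Sum>\<^sub>n c\<^sub>j(n) e\<^bsup>int\<xi>\<^esup>\<close> to the values of the spectrum of
  a finite sum \<open>\<Sum> c\<^sub>j(n) \<tau>\<^bsub>nt\<^esub> \<phi>\<^sub>j\<close>, so the square norm of that sum is comparable to
  \<open>\<Sum> |c\<^sub>j(n)|\<^sup>2\<close>. The lower bound makes the synthesis operator injective; the upper bound makes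
  its partial sums Cauchy, and completeness of \<open>L\<^sup>2\<close> provides the limit.

  The two analytic ingredients are Parseval's identity on a period and Plancherel's theorem on the
  line. Parseval follows from Bessel's inequality and the density of trigonometric polynomials
  (Stone--Weierstrass on the circle). Plancherel is deduced from it: for compactly supported \<open>h\<close>,
  Parseval computes the square sum of its transform over every translate of a fine enough lattice, and
  integrating over the translates gives the square norm of the transform. The limit in the synthesis
  argument has the right spectrum because the relation \<open>has_fourier\<close> is closed under simultaneous
  \<open>L\<^sup>2\<close> limits of both sides, which takes the place of Fourier inversion.
\<close>

section \<open>Square norms and completeness of \<open>L\<^sup>2\<close>\<close>

text \<open>The square of the \<open>L\<^sup>2\<close> norm, with values in the extended nonnegative reals so that it is
  meaningful before integrability is known.\<close>
definition sq_norm :: "'a measure \<Rightarrow> ('a \<Rightarrow> complex) \<Rightarrow> ennreal" where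
  "sq_norm M f = (\<integral>\<^sup>+ x. ennreal ((cmod (f x))\<^sup>2) \<partial>M)"

lemma L2_tendsto_sq_norm:
  "L2_tendsto u f F \<longleftrightarrow> ((\<lambda>a. sq_norm lborel (\<lambda>x. u a x - f x)) \<longlongrightarrow> 0) F"
  by (simp add: L2_tendsto_def sq_norm_def)

lemma L2_iff: "f \<in> L2 \<longleftrightarrow> f \<in> borel_measurable borel \<and> sq_norm lborel f < \<infinity>"
proof (cases "f \<in> borel_measurable borel")
  case True
  then have "(\<lambda>x. (cmod (f x))\<^sup>2) \<in> borel_measurable borel" by measurable
  then show ?thesis
    using True by (auto simp: L2_def sq_norm_def integrable_iff_bounded)
qed (auto simp: L2_def)

lemma sq_norm_cong_AE:
  "(AE x in M. f x = g x) \<Longrightarrow> sq_norm M f = sq_norm M g"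
  unfolding sq_norm_def by (intro nn_integral_cong_AE) auto

lemma sq_norm_mono:
  "(\<And>x. cmod (f x) \<le> cmod (g x)) \<Longrightarrow> sq_norm M f \<le> sq_norm M g"
  unfolding sq_norm_def by (intro nn_integral_mono ennreal_leI power_mono) auto

lemma sq_norm_minus_commute: "sq_norm M (\<lambda>x. f x - g x) = sq_norm M (\<lambda>x. g x - f x)"
  by (simp add: sq_norm_def norm_minus_commute)

lemma sq_norm_cmult:
  assumes "f \<in> borel_measurable M"
  shows "sq_norm M (\<lambda>x. c * f x) = ennreal ((cmod c)\<^sup>2) * sq_norm M f"
proof -
  have "(\<lambda>x. ennreal ((cmod (f x))\<^sup>2)) \<in> borel_measurable M" using assms by measurable
  then show ?thesis
    unfolding sq_norm_def norm_mult power_mult_distrib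
    by (subst nn_integral_cmult[symmetric]) (auto simp: ennreal_mult)
qed

text \<open>From \<open>2ab \<le> e a\<^sup>2 + b\<^sup>2/e\<close>. With \<open>e = 1\<close> it replaces the triangle inequality in
  convergence arguments; with \<open>e\<close> tending to 0 it yields sharp comparisons of norms.\<close>
lemma sq_norm_add_weighted:
  assumes [measurable]: "f \<in> borel_measurable M" "g \<in> borel_measurable M" and "e > 0"
  shows "sq_norm M (\<lambda>x. f x + g x) \<le> ennreal (1 + e) * sq_norm M f + ennreal (1 + 1 / e) * sq_norm M g"
proof -
  have *: "(cmod (a + b))\<^sup>2 \<le> (1 + e) * (cmod a)\<^sup>2 + (1 + 1 / e) * (cmod b)\<^sup>2" for a b
  proof -
    have "(cmod (a + b))\<^sup>2 \<le> (cmod a + cmod b)\<^sup>2"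
      by (intro power_mono norm_triangle_ineq) auto
    moreover have "0 \<le> (e * cmod a - cmod b)\<^sup>2 / e"
      using \<open>e > 0\<close> by simp
    moreover have "(e * cmod a - cmod b)\<^sup>2 / e = e * (cmod a)\<^sup>2 - 2 * cmod a * cmod b + (cmod b)\<^sup>2 / e"
      using \<open>e > 0\<close> by (simp add: field_simps power2_eq_square)
    ultimately show ?thesis
      by (simp add: power2_sum algebra_simps)
  qed
  have "sq_norm M (\<lambda>x. f x + g x) \<le>
      (\<integral>\<^sup>+ x. (ennreal (1 + e) * ennreal ((cmod (f x))\<^sup>2) + ennreal (1 + 1 / e) * ennreal ((cmod (g x))\<^sup>2)) \<partial>M)"
    unfolding sq_norm_def
  proof (rule nn_integral_mono)
    fix x
    have "ennreal (1 + e) * ennreal ((cmod (f x))\<^sup>2) + ennreal (1 + 1 / e) * ennreal ((cmod (g x))\<^sup>2)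
       = ennreal ((1 + e) * (cmod (f x))\<^sup>2 + (1 + 1 / e) * (cmod (g x))\<^sup>2)"
      using \<open>e > 0\<close> by (simp add: ennreal_mult[symmetric] ennreal_plus[symmetric] del: ennreal_plus)
    then show "ennreal ((cmod (f x + g x))\<^sup>2) \<le> ennreal (1 + e) * ennreal ((cmod (f x))\<^sup>2) + ennreal (1 + 1 / e) * ennreal ((cmod (g x))\<^sup>2)"
      using *[of "f x" "g x"] by (simp add: ennreal_leI)
  qed
  also have "\<dots> = ennreal (1 + e) * sq_norm M f + ennreal (1 + 1 / e) * sq_norm M g"
    unfolding sq_norm_def by (subst nn_integral_add) (auto simp: nn_integral_cmult)
  finally show ?thesis .
qed

lemma sq_norm_add_le:
  assumes "f \<in> borel_measurable M" "g \<in> borel_measurable M"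
  shows "sq_norm M (\<lambda>x. f x + g x) \<le> 2 * sq_norm M f + 2 * sq_norm M g"
  using sq_norm_add_weighted[OF assms, of 1] by simp

lemma sq_norm_add_finite:
  assumes "f \<in> borel_measurable M" "g \<in> borel_measurable M" "sq_norm M f < \<infinity>" "sq_norm M g < \<infinity>"
  shows "sq_norm M (\<lambda>x. f x + g x) < \<infinity>"
proof -
  have "2 * sq_norm M f + 2 * sq_norm M g < \<infinity>"
    using assms(3,4) by (simp add: ennreal_mult_less_top)
  then show ?thesis using sq_norm_add_le[OF assms(1,2)] by (rule order.strict_trans1[rotated])
qed

lemma sq_norm_diff_le:
  assumes [measurable]: "f \<in> borel_measurable M" "g \<in> borel_measurable M" "h \<in> borel_measurable M"
  shows "sq_norm M (\<lambda>x. f x - h x) \<le> 2 * sq_norm M (\<lambda>x. f x - g x) + 2 * sq_norm M (\<lambda>x. g x - h x)"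
  using sq_norm_add_le[of "\<lambda>x. f x - g x" M "\<lambda>x. g x - h x"] by simp

lemma sq_norm_integrable:
  assumes [measurable]: "f \<in> borel_measurable M" and "sq_norm M f < \<infinity>"
  shows "integrable M (\<lambda>x. (cmod (f x))\<^sup>2)" "sq_norm M f = ennreal (\<integral>x. (cmod (f x))\<^sup>2 \<partial>M)"
proof -
  show "integrable M (\<lambda>x. (cmod (f x))\<^sup>2)"
    using assms(2) by (intro integrableI_bounded) (auto simp: sq_norm_def)
  then show "sq_norm M f = ennreal (\<integral>x. (cmod (f x))\<^sup>2 \<partial>M)"
    unfolding sq_norm_def by (subst nn_integral_eq_integral) auto
qed

lemma L2_add: "f \<in> L2 \<Longrightarrow> g \<in> L2 \<Longrightarrow> (\<lambda>x. f x + g x) \<in> L2"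
  using sq_norm_add_finite[of f lborel g] by (auto simp: L2_iff)

lemma L2_cmult: "f \<in> L2 \<Longrightarrow> (\<lambda>x. c * f x) \<in> L2"
  by (auto simp: L2_iff sq_norm_cmult ennreal_mult_less_top)

lemma L2_diff: "f \<in> L2 \<Longrightarrow> g \<in> L2 \<Longrightarrow> (\<lambda>x. f x - g x) \<in> L2"
  using L2_add[of f "\<lambda>x. (-1) * g x"] L2_cmult[of g "-1"] by simp

lemma L2_zero: "(\<lambda>x. 0) \<in> L2"
  by (simp add: L2_iff sq_norm_def)

lemma L2_bounded_mult:
  assumes "f \<in> L2" "m \<in> borel_measurable borel" "\<And>x. f x \<noteq> 0 \<Longrightarrow> cmod (m x) \<le> B"
  shows "(\<lambda>x. m x * f x) \<in> L2"
proof -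
  have [measurable]: "f \<in> borel_measurable borel" and fin: "sq_norm lborel f < \<infinity>" 
    using assms(1) by (auto simp: L2_iff)
  have "cmod (m x * f x) \<le> cmod (complex_of_real \<bar>B\<bar> * f x)" for x
    using assms(3)[of x] by (cases "f x = 0") (auto simp: norm_mult intro!: mult_right_mono)
  then have "sq_norm lborel (\<lambda>x. m x * f x) \<le> sq_norm lborel (\<lambda>x. complex_of_real \<bar>B\<bar> * f x)"
    by (rule sq_norm_mono)
  also have "\<dots> < \<infinity>"
    using fin by (subst sq_norm_cmult) (auto simp: ennreal_mult_less_top)
  finally show ?thesis using assms by (auto simp: L2_iff)
qed

lemma L2_shift:
  assumes "f \<in> L2" shows "shift a f \<in> L2"
proof -
  have [measurable]: "f \<in> borel_measurable borel" using assms by (simp add: L2_iff)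
  have "sq_norm lborel (shift a f) = sq_norm lborel f"
    unfolding sq_norm_def shift_def
    by (subst (2) nn_integral_real_affine[where c = 1 and t = a]) (auto simp: add.commute)
  then show ?thesis using assms unfolding L2_iff shift_def by simp
qed

lemma le_if_le_weighted:
  fixes s K :: ennreal
  assumes "\<And>e. e > 0 \<Longrightarrow> s \<le> ennreal (1 + e) * K"
  shows "s \<le> K"
proof (cases "K = \<infinity>")
  case False
  show ?thesis
  proof (rule tendsto_lowerbound)
    show "((\<lambda>e. ennreal (1 + e) * K) \<longlongrightarrow> K) (at_right 0)"
    proof -
      have "((\<lambda>e. K * ennreal (1 + e)) \<longlongrightarrow> K * ennreal (1 + 0)) (at_right 0)"
        using False by (intro ennreal_tendsto_cmult tendsto_ennrealI tendsto_intros) (auto simp: top.not_eq_extremum)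
      then show ?thesis by (simp add: mult.commute)
    qed
    show "\<forall>\<^sub>F e in at_right 0. s \<le> ennreal (1 + e) * K"
      using assms by (auto simp: eventually_at_filter)
  qed auto
qed auto

text \<open>An isometry passes to limits: two families with equal norms have limits with equal norms
  (apply the inequality in both directions). The two families may live on different spaces, as they
  do for a function and its Fourier transform.\<close>
lemma sq_norm_limits_le:
  assumes [measurable]: "\<And>a. u a \<in> borel_measurable M" "g \<in> borel_measurable M"
      "\<And>a. v a \<in> borel_measurable M'" "f \<in> borel_measurable M'"
    and u: "((\<lambda>a. sq_norm M (\<lambda>x. u a x - g x)) \<longlongrightarrow> 0) F"
    and v: "((\<lambda>a. sq_norm M' (\<lambda>x. v a x - f x)) \<longlongrightarrow> 0) F"
    and eq: "\<And>a. sq_norm M (u a) = sq_norm M' (v a)" and "F \<noteq> bot"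
  shows "sq_norm M g \<le> sq_norm M' f"
proof (rule le_if_le_weighted, rule le_if_le_weighted)
  fix e d :: real assume e: "e > 0" and d: "d > 0"
  let ?r = "\<lambda>a. ennreal (1 + d) * (ennreal (1 + e) * sq_norm M' f
      + ennreal (1 + 1/e) * sq_norm M' (\<lambda>x. v a x - f x)) + ennreal (1 + 1/d) * sq_norm M (\<lambda>x. u a x - g x)"
  have le: "sq_norm M g \<le> ?r a" for a
  proof -
    have "sq_norm M g \<le> ennreal (1 + d) * sq_norm M (u a) + ennreal (1 + 1/d) * sq_norm M (\<lambda>x. u a x - g x)"
      using sq_norm_add_weighted[of "u a" M "\<lambda>x. g x - u a x" d] d
      by (simp add: sq_norm_minus_commute[of _ "u a"])
    also have "sq_norm M (u a) \<le> ennreal (1 + e) * sq_norm M' f + ennreal (1 + 1/e) * sq_norm M' (\<lambda>x. v a x - f x)"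
      unfolding eq using sq_norm_add_weighted[of f M' "\<lambda>x. v a x - f x" e] e by simp
    finally show ?thesis by (simp add: add_mono mult_left_mono)
  qed
  have "(?r \<longlongrightarrow> ennreal (1 + d) * (ennreal (1 + e) * sq_norm M' f + ennreal (1 + 1/e) * 0) + ennreal (1 + 1/d) * 0) F"
    by (intro tendsto_intros ennreal_tendsto_cmult u v) auto
  then show "sq_norm M g \<le> ennreal (1 + d) * (ennreal (1 + e) * sq_norm M' f)"
    using le \<open>F \<noteq> bot\<close> by (intro tendsto_lowerbound) auto
qed

text \<open>The Riesz--Fischer theorem. Along a subsequence whose increments \<open>d\<^sub>k\<close> have square norm at
  most \<open>8\<^bsup>-k\<^esup>\<close>, the sum of \<open>2\<^sup>k |d\<^sub>k|\<^sup>2\<close> is integrable, hence finite almost everywhere; there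
  \<open>|d\<^sub>k|\<close> decays geometrically and the subsequence converges. Fatou's lemma turns the pointwise limit
  into a limit in \<open>L\<^sup>2\<close>.\<close>
lemma L2_complete:
  fixes u :: "nat \<Rightarrow> 'a \<Rightarrow> complex"
  assumes [measurable]: "\<And>n. u n \<in> borel_measurable M"
    and Cauchy: "\<And>e::real. e > 0 \<Longrightarrow> \<exists>N. \<forall>m\<ge>N. \<forall>n\<ge>N. sq_norm M (\<lambda>x. u m x - u n x) \<le> ennreal e"
  obtains f where "f \<in> borel_measurable M" "(\<lambda>n. sq_norm M (\<lambda>x. u n x - f x)) \<longlonglongrightarrow> 0"
proof -
  have "\<forall>k. \<exists>N. \<forall>m\<ge>N. \<forall>n\<ge>N. sq_norm M (\<lambda>x. u m x - u n x) \<le> ennreal ((1/8)^k)"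
    using Cauchy by simp
  then obtain R where R: "\<And>k m n. m \<ge> R k \<Longrightarrow> n \<ge> R k \<Longrightarrow> sq_norm M (\<lambda>x. u m x - u n x) \<le> ennreal ((1/8)^k)"
    by metis
  \<comment> \<open>Partial sums make the thresholds monotone: \<open>r j \<ge> R k\<close> whenever \<open>j \<ge> k\<close>.\<close>
  define r where "r k = (\<Sum>i\<le>k. R i)" for k
  have r_ge: "R k \<le> r j" if "k \<le> j" for k j
    unfolding r_def using that by (intro member_le_sum) auto
  define d where "d k x = u (r (Suc k)) x - u (r k) x" for k x
  have [measurable]: "d k \<in> borel_measurable M" for k
    unfolding d_def by measurable
  have d: "sq_norm M (d k) \<le> ennreal ((1/8)^k)" for k
    unfolding d_def by (intro R r_ge) auto
  have "(\<integral>\<^sup>+x. (\<Sum>k. ennreal (2^k * (cmod (d k x))\<^sup>2)) \<partial>M) = (\<Sum>k. ennreal (2^k) * sq_norm M (d k))"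
    unfolding sq_norm_def
    by (subst nn_integral_suminf) (auto simp: ennreal_mult nn_integral_cmult)
  also have "\<dots> \<le> (\<Sum>k. ennreal ((1/4)^k))"
  proof (intro suminf_le allI)
    fix k
    have "ennreal (2^k) * sq_norm M (d k) \<le> ennreal (2^k) * ennreal ((1/8)^k)"
      by (intro mult_left_mono d) auto
    also have "\<dots> = ennreal ((1/4)^k)"
      by (simp add: ennreal_mult[symmetric] power_mult_distrib[symmetric])
    finally show "ennreal (2^k) * sq_norm M (d k) \<le> ennreal ((1/4)^k)" .
  qed auto
  also have "\<dots> = ennreal (\<Sum>k. (1/4)^k)"
    by (intro suminf_ennreal2 summable_geometric) auto
  finally have "(\<integral>\<^sup>+x. (\<Sum>k. ennreal (2^k * (cmod (d k x))\<^sup>2)) \<partial>M) \<noteq> \<infinity>"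
    by (auto simp: top_unique)
  then have "AE x in M. (\<Sum>k. ennreal (2^k * (cmod (d k x))\<^sup>2)) \<noteq> \<infinity>"
    by (intro nn_integral_PInf_AE) auto
  then have conv: "AE x in M. convergent (\<lambda>k. u (r k) x)"
  proof eventually_elim
    case (elim x)
    have s: "summable (\<lambda>k. 2^k * (cmod (d k x))\<^sup>2)"
      using elim by (intro summable_suminf_not_top) auto
    then have "bounded (range (\<lambda>k. 2^k * (cmod (d k x))\<^sup>2))"
      by (intro convergent_imp_bounded) (auto dest: summable_LIMSEQ_zero)
    then obtain C where C: "\<And>k. 2^k * (cmod (d k x))\<^sup>2 \<le> C"
      by (auto simp: bounded_real)
    have "norm (d k x) \<le> sqrt C * (1 / sqrt 2)^k" for k
    proof -
      have "(sqrt 2)^k * norm (d k x) = sqrt (2^k * (cmod (d k x))\<^sup>2)"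
        by (simp add: real_sqrt_mult real_sqrt_power)
      also have "\<dots> \<le> sqrt C" using C[of k] by simp
      finally show ?thesis by (simp add: field_simps power_divide)
    qed
    then have "summable (\<lambda>k. d k x)"
      by (intro summable_comparison_test[OF _ summable_mult[OF summable_geometric]]) auto
    then have "convergent (\<lambda>n. \<Sum>k<n. d k x)"
      by (simp add: summable_iff_convergent)
    moreover have "(\<Sum>k<n. d k x) = u (r n) x - u (r 0) x" for n
      unfolding d_def by (rule sum_lessThan_telescope)
    ultimately have "convergent (\<lambda>n. u (r n) x - u (r 0) x)" by simp
    then have "convergent (\<lambda>n. (u (r n) x - u (r 0) x) + u (r 0) x)"
      by (intro convergent_add convergent_const)
    then show ?case by simp
  qed
  define f where "f x = lim (\<lambda>k. u (r k) x)" for x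
  have [measurable]: "f \<in> borel_measurable M"
    unfolding f_def by measurable
  have bound: "sq_norm M (\<lambda>x. u n x - f x) \<le> ennreal ((1/8)^k)" if "n \<ge> R k" for n k
  proof -
    have "sq_norm M (\<lambda>x. u n x - f x) = (\<integral>\<^sup>+x. liminf (\<lambda>j. ennreal ((cmod (u n x - u (r j) x))\<^sup>2)) \<partial>M)"
      unfolding sq_norm_def
    proof (rule nn_integral_cong_AE)
      show "AE x in M. ennreal ((cmod (u n x - f x))\<^sup>2) = liminf (\<lambda>j. ennreal ((cmod (u n x - u (r j) x))\<^sup>2))"
        using conv
      proof eventually_elim
        case (elim x)
        then have "(\<lambda>j. u (r j) x) \<longlonglongrightarrow> f x"
          by (simp add: convergent_LIMSEQ_iff f_def)
        then have "(\<lambda>j. ennreal ((cmod (u n x - u (r j) x))\<^sup>2)) \<longlonglongrightarrow> ennreal ((cmod (u n x - f x))\<^sup>2)"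
          by (intro tendsto_intros tendsto_ennrealI)
        then show ?case by (rule lim_imp_Liminf[OF sequentially_bot, symmetric])
      qed
    qed
    also have "\<dots> \<le> liminf (\<lambda>j. sq_norm M (\<lambda>x. u n x - u (r j) x))"
      unfolding sq_norm_def by (intro nn_integral_liminf) auto
    also have "\<dots> \<le> ennreal ((1/8)^k)"
    proof (rule Liminf_le)
      show "\<forall>\<^sub>F j in sequentially. sq_norm M (\<lambda>x. u n x - u (r j) x) \<le> ennreal ((1/8)^k)"
        using eventually_ge_at_top[of k] by eventually_elim (intro R that r_ge)
    qed auto
    finally show ?thesis .
  qed
  have "(\<lambda>n. sq_norm M (\<lambda>x. u n x - f x)) \<longlonglongrightarrow> 0"
  proof (rule order_tendstoI)
    fix y :: ennreal assume "0 < y"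
    have "(\<lambda>k. ennreal ((1/8)^k)) \<longlonglongrightarrow> ennreal 0"
      by (intro tendsto_ennrealI LIMSEQ_power_zero) auto
    then have "\<forall>\<^sub>F k in sequentially. ennreal ((1/8)^k) < y"
      using \<open>0 < y\<close> by (intro order_tendstoD(2)) auto
    then obtain k where k: "ennreal ((1/8)^k) < y" by (auto simp: eventually_sequentially)
    show "\<forall>\<^sub>F n in sequentially. sq_norm M (\<lambda>x. u n x - f x) < y"
      using eventually_ge_at_top[of "R k"]
      by eventually_elim (use bound k in \<open>auto intro: order.strict_trans1\<close>)
  qed auto
  then show ?thesis using that[of f] by auto
qed

section \<open>Fourier series on a period\<close>
definition mode :: "real \<Rightarrow> int \<Rightarrow> real \<Rightarrow> complex" where
  "mode t n x = cis (of_int n * t * x)"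

abbreviation period_measure :: "real \<Rightarrow> real \<Rightarrow> real measure" where
  "period_measure t a \<equiv> restrict_space lborel {a..<a + 2 * pi / t}"

lemma norm_mode [simp]: "cmod (mode t n x) = 1"
  by (simp add: mode_def)

lemma mode_mult: "mode t n x * mode t m x = mode t (n + m) x"
  by (simp add: mode_def cis_mult algebra_simps)

lemma cnj_mode: "cnj (mode t n x) = mode t (- n) x"
  by (simp add: mode_def cis_cnj)

lemma mode_mult_cnj: "mode t n x * cnj (mode t m x) = mode t (n - m) x"
  by (simp add: cnj_mode mode_mult)

lemma continuous_on_mode [continuous_intros]: "continuous_on S (mode t n)"
  unfolding mode_def[abs_def] by (intro continuous_intros)

lemma borel_measurable_mode [measurable]: "mode t n \<in> borel_measurable borel"
  by (intro borel_measurable_continuous_onI continuous_intros)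

lemma mode_period: "t > 0 \<Longrightarrow> mode t n (x + of_int k * (2 * pi / t)) = mode t n x"
proof -
  assume "t > 0"
  have "mode t n (x + of_int k * (2 * pi / t)) = cis (of_int n * t * x) * cis (2 * pi * of_int (n * k))"
    using \<open>t > 0\<close> by (simp add: mode_def cis_mult distrib_left mult_ac)
  also have "cis (2 * pi * of_int (n * k)) = 1" by (rule cis_multiple_2pi) auto
  finally show ?thesis by (simp add: mode_def)
qed

lemma borel_measurable_period:
  "f \<in> borel_measurable borel \<Longrightarrow> f \<in> borel_measurable (period_measure t a)"
  by (rule measurable_restrict_space1) simp

lemma finite_measure_period: "finite_measure (period_measure t a)"
proof (rule finite_measureI)
  have "emeasure lborel {a..<a + 2 * pi / t} < \<infinity>"
    by (intro emeasure_bounded_finite bounded_subset[OF bounded_closed_interval[of a "a + 2 * pi / t"]]) auto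
  then show "emeasure (period_measure t a) (space (period_measure t a)) \<noteq> \<infinity>"
    by (simp add: emeasure_restrict_space space_restrict_space)
qed

lemma L2_finite_measure_integrable:
  assumes "finite_measure M" and [measurable]: "f \<in> borel_measurable M" and "sq_norm M f < \<infinity>"
  shows "integrable M f"
proof (rule Bochner_Integration.integrable_bound)
  interpret finite_measure M by fact
  show "integrable M (\<lambda>x. 1 + (cmod (f x))\<^sup>2)"
    using sq_norm_integrable(1)[OF assms(2,3)] by auto
  have "r \<le> 1 + r\<^sup>2" for r :: real
    using zero_le_power2[of "r - 1/2"] by (simp add: power2_eq_square field_simps)
  then show "AE x in M. norm (f x) \<le> norm (1 + (cmod (f x))\<^sup>2)"
    by (auto intro: order_trans[OF _ abs_ge_self])
qed auto

lemma integral_mode: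
  assumes "t > 0"
  shows "(\<integral>x. mode t n x \<partial>period_measure t a) = (if n = 0 then 2 * pi / t else 0)"
proof -
  define b where "b = a + 2 * pi / t"
  have ab: "a \<le> b" using assms by (simp add: b_def)
  have "(\<integral>x. mode t n x \<partial>period_measure t a) = (\<integral>x. indicator {a..<b} x *\<^sub>R mode t n x \<partial>lborel)"
    by (subst integral_restrict_space) (auto simp: b_def)
  also have "\<dots> = (\<integral>x. indicator {a..b} x *\<^sub>R mode t n x \<partial>lborel)"
    by (intro integral_cong_AE)
       (auto intro!: eventually_mono[OF AE_lborel_singleton[of b]] simp: indicator_def)
  also have "\<dots> = (if n = 0 then 2 * pi / t else 0)"
  proof (cases "n = 0")
    case True
    then show ?thesis
      using ab by (simp add: mode_def b_def scaleR_conv_of_real)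
  next
    case False
    define F where "F x = mode t n x / (\<i> * (of_int n * t))" for x
    have "(\<integral>x. indicator {a..b} x *\<^sub>R mode t n x \<partial>lborel) = F b - F a"
    proof (rule integral_FTC_Icc[OF ab])
      fix x
      have "((\<lambda>x. mode t n x) has_derivative (\<lambda>y. (y * (of_int n * t)) *\<^sub>R (\<i> * mode t n x))) (at x within {a..b})"
        unfolding mode_def
        by (rule has_derivative_eq_rhs, rule has_derivative_cis, (rule derivative_intros)+)
           (auto simp: algebra_simps)
      then have "((\<lambda>x. mode t n x / (\<i> * (of_int n * t))) has_derivative
          (\<lambda>y. ((y * (of_int n * t)) *\<^sub>R (\<i> * mode t n x)) / (\<i> * (of_int n * t)))) (at x within {a..b})"
        by (rule bounded_linear.has_derivative[OF bounded_linear_divide])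
      also have "(\<lambda>y. ((y * (of_int n * t)) *\<^sub>R (\<i> * mode t n x)) / (\<i> * (of_int n * t))) = (\<lambda>y. y *\<^sub>R mode t n x)"
        using False assms by (auto simp: scaleR_conv_of_real fun_eq_iff field_simps)
      finally show "(F has_vector_derivative mode t n x) (at x within {a..b})"
        unfolding has_vector_derivative_def F_def .
    qed (intro continuous_intros)
    also have "F b = F a"
      using mode_period[OF assms, of n a 1] by (simp add: F_def b_def)
    finally show ?thesis using False by simp
  qed
  finally show ?thesis .
qed

text \<open>Closure under addition rather than an explicit finite sum is the definition, because products and
  polynomials in \<open>cos\<close> and \<open>sin\<close> are then handled by induction.\<close>
inductive_set trig_poly :: "real \<Rightarrow> (real \<Rightarrow> complex) set" for t where
  trig_poly_mode: "(\<lambda>x. c * mode t n x) \<in> trig_poly t"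
| trig_poly_add: "f \<in> trig_poly t \<Longrightarrow> g \<in> trig_poly t \<Longrightarrow> (\<lambda>x. f x + g x) \<in> trig_poly t"

lemma trig_poly_expansion:
  assumes "f \<in> trig_poly t"
  obtains N d where "finite N" "f = (\<lambda>x. \<Sum>n\<in>N. d n * mode t n x)"
proof -
  have "\<exists>N d. finite N \<and> f = (\<lambda>x. \<Sum>n\<in>N. d n * mode t n x)"
    using assms
  proof induction
    case (trig_poly_mode c n)
    show ?case by (intro exI[of _ "{n}"] exI[of _ "\<lambda>_. c"]) simp
  next
    case (trig_poly_add f g)
    then obtain N d N' d' where
      N: "finite N" "f = (\<lambda>x. \<Sum>n\<in>N. d n * mode t n x)"
      and N': "finite N'" "g = (\<lambda>x. \<Sum>n\<in>N'. d' n * mode t n x)" by blast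
    have "f x = (\<Sum>n\<in>N \<union> N'. (if n \<in> N then d n else 0) * mode t n x)" for x
      unfolding N by (rule sum.mono_neutral_cong_left) (use N N' in auto)
    moreover have "g x = (\<Sum>n\<in>N \<union> N'. (if n \<in> N' then d' n else 0) * mode t n x)" for x
      unfolding N' by (rule sum.mono_neutral_cong_left) (use N N' in auto)
    ultimately have "(\<lambda>x. f x + g x) = (\<lambda>x. \<Sum>n\<in>N \<union> N'. ((if n \<in> N then d n else 0) + (if n \<in> N' then d' n else 0)) * mode t n x)"
      by (simp add: sum.distrib distrib_right)
    then show ?case using N(1) N'(1) by (intro exI[of _ "N \<union> N'"] exI conjI) auto
  qed
  then show ?thesis using that by blast
qed

lemma trig_poly_const: "(\<lambda>x. c) \<in> trig_poly t"
  using trig_poly_mode[of c t 0] by (simp add: mode_def)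

lemma trig_poly_mult:
  assumes "f \<in> trig_poly t" "g \<in> trig_poly t"
  shows "(\<lambda>x. f x * g x) \<in> trig_poly t"
  using assms(1)
proof induction
  case (trig_poly_mode c n)
  show ?case using assms(2)
  proof induction
    case (trig_poly_mode d m)
    then show ?case
      using trig_poly.trig_poly_mode[of "c * d" t "n + m"]
      by (simp add: mode_mult[symmetric] algebra_simps)
  next
    case (trig_poly_add f g)
    then show ?case using trig_poly.trig_poly_add by (simp add: distrib_left)
  qed
next
  case (trig_poly_add f g)
  then show ?case using trig_poly.trig_poly_add by (simp add: distrib_right)
qed

text \<open>On the unit circle the coordinates are \<open>(z + z\<^bsup>-1\<^esup>)/2\<close> and \<open>(z - z\<^bsup>-1\<^esup>)/(2i)\<close>, so real
  polynomials restrict to trigonometric polynomials.\<close>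
lemma real_polynomial_on_circle:
  assumes "real_polynomial_function g"
  shows "(\<lambda>x. complex_of_real (g (cis (t * x)))) \<in> trig_poly t"
  using assms
proof induction
  case (linear f)
  have eq: "complex_of_real (f (cis (t * x))) =
     (complex_of_real (f 1) - \<i> * complex_of_real (f \<i>)) / 2 * mode t 1 x
   + (complex_of_real (f 1) + \<i> * complex_of_real (f \<i>)) / 2 * mode t (-1) x" for x
  proof -
    interpret bounded_linear f by fact
    have "cis (t * x) = cos (t * x) *\<^sub>R 1 + sin (t * x) *\<^sub>R \<i>"
      by (simp add: complex_eq_iff)
    then have "f (cis (t * x)) = cos (t * x) * f 1 + sin (t * x) * f \<i>"
      by (simp only: add scaleR real_scaleR_def)
    then show ?thesis
      by (simp add: mode_def complex_eq_iff field_simps)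
  qed
  show ?case unfolding eq by (intro trig_poly.intros)
next
  case (mult f g)
  then show ?case using trig_poly_mult by simp
next
  case (add f g)
  then show ?case using trig_poly.trig_poly_add by simp
qed (rule trig_poly_const)

text \<open>A function with equal end values descends to a function \<open>h\<close> on the circle. Its graph is the
  image of the compact interval under \<open>x \<mapsto> (e\<^bsup>itx\<^esup>, u x)\<close>, hence closed, so \<open>h\<close> is continuous and
  the Stone--Weierstrass theorem applies to its real and imaginary parts.\<close>
lemma trig_poly_uniformly_dense:
  fixes u :: "real \<Rightarrow> complex"
  assumes t: "t > 0" and cont: "continuous_on {a..a + 2 * pi / t} u" and per: "u a = u (a + 2 * pi / t)"
    and "e > 0"
  obtains s where "s \<in> trig_poly t" "\<And>x. x \<in> {a..a + 2 * pi / t} \<Longrightarrow> cmod (u x - s x) < e"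
proof -
  let ?I = "{a..a + 2 * pi / t}"
  let ?C = "(\<lambda>x. cis (t * x)) ` ?I"
  have eq: "u x = u y" if "x \<in> ?I" "y \<in> ?I" "cis (t * x) = cis (t * y)" "x \<le> y" for x y
  proof -
    obtain k :: int where k: "t * y = t * x + 2 * pi * k"
      using \<open>cis (t * x) = cis (t * y)\<close> sin_cos_eq_iff[of "t * y" "t * x"] by (auto simp: complex_eq_iff)
    have "of_int k * (2 * pi) = t * (y - x)" using k by (simp add: algebra_simps)
    then have "y - x = of_int k * (2 * pi / t)"
      using t by (simp add: field_simps)
    moreover have "0 \<le> y - x" "y - x \<le> 1 * (2 * pi / t)" using that by auto
    moreover have "2 * pi / t > 0" using t by simp
    ultimately have "0 \<le> of_int k * (2 * pi / t)" "of_int k * (2 * pi / t) \<le> 1 * (2 * pi / t)"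
      by simp_all
    then have "0 \<le> k" "k \<le> 1"
      using \<open>2 * pi / t > 0\<close> by (auto simp: zero_le_mult_iff mult_le_cancel_right1 simp del: times_divide_eq_right)
    then have "k = 0 \<or> k = 1" by auto
    then show ?thesis
    proof
      assume "k = 1"
      then have "y - x = 2 * pi / t" using \<open>y - x = of_int k * (2 * pi / t)\<close> by simp
      then have "x = a" "y = a + 2 * pi / t" using that by auto
      then show ?thesis using per by simp
    qed (use \<open>y - x = of_int k * (2 * pi / t)\<close> in auto)
  qed
  define h where "h z = u (SOME x. x \<in> ?I \<and> cis (t * x) = z)" for z
  have h: "h (cis (t * x)) = u x" if "x \<in> ?I" for x
  proof -
    have "(SOME y. y \<in> ?I \<and> cis (t * y) = cis (t * x)) \<in> ?I \<and>
          cis (t * (SOME y. y \<in> ?I \<and> cis (t * y) = cis (t * x))) = cis (t * x)"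
      using that by (intro someI[of "\<lambda>y. y \<in> ?I \<and> cis (t * y) = cis (t * x)"]) auto
    then show ?thesis
      unfolding h_def using eq[of x "SOME y. y \<in> ?I \<and> cis (t * y) = cis (t * x)"]
        eq[of "SOME y. y \<in> ?I \<and> cis (t * y) = cis (t * x)" x] that linear by fastforce
  qed
  have "continuous_on ?C h"
  proof (rule continuous_from_closed_graph)
    show "compact (u ` ?I)" by (intro compact_continuous_image cont) auto
    show "h \<in> ?C \<rightarrow> u ` ?I" using h by auto
    have "(\<lambda>z. (z, h z)) ` ?C = (\<lambda>x. (cis (t * x), u x)) ` ?I"
      unfolding image_image using h by (intro image_cong) auto
    moreover have "compact \<dots>"
      by (intro compact_continuous_image continuous_intros cont) auto
    ultimately show "closed ((\<lambda>z. (z, h z)) ` ?C)" by (simp add: compact_imp_closed)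
  qed
  moreover have "compact ?C" by (intro compact_continuous_image continuous_intros) auto
  moreover have "e / 2 > 0" using \<open>e > 0\<close> by simp
  ultimately have contRe: "continuous_on ?C (\<lambda>z. Re (h z))" and contIm: "continuous_on ?C (\<lambda>z. Im (h z))"
    and C: "compact ?C" and e2: "e / 2 > 0"
    by (auto intro: continuous_intros)
  obtain p where p: "real_polynomial_function p" "\<And>z. z \<in> ?C \<Longrightarrow> \<bar>Re (h z) - p z\<bar> < e / 2"
    by (rule Stone_Weierstrass_real_polynomial_function[OF C contRe e2]) (rule that)
  obtain q where q: "real_polynomial_function q" "\<And>z. z \<in> ?C \<Longrightarrow> \<bar>Im (h z) - q z\<bar> < e / 2"
    by (rule Stone_Weierstrass_real_polynomial_function[OF C contIm e2]) (rule that)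
  define s where "s x = complex_of_real (p (cis (t * x))) + \<i> * complex_of_real (q (cis (t * x)))" for x
  have "s \<in> trig_poly t"
    unfolding s_def[abs_def]
    by (intro trig_poly.trig_poly_add trig_poly_mult trig_poly_const real_polynomial_on_circle p q)
  moreover have "cmod (u x - s x) < e" if "x \<in> ?I" for x
  proof -
    have "cmod (u x - s x) \<le> \<bar>Re (u x - s x)\<bar> + \<bar>Im (u x - s x)\<bar>" by (rule cmod_le)
    also have "\<dots> < e / 2 + e / 2"
      using p(2)[of "cis (t * x)"] q(2)[of "cis (t * x)"] that h[OF that]
      by (intro add_strict_mono) (auto simp: s_def)
    finally show ?thesis by simp
  qed
  ultimately show ?thesis using that by blast
qed

text \<open>The radial retraction onto the disc of radius \<open>K\<close>. It is continuous, so clipping keeps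
  continuous approximants continuous while supplying the bound needed for dominated convergence.\<close>
definition clip :: "real \<Rightarrow> complex \<Rightarrow> complex" where
  "clip K z = (K / max K (cmod z)) *\<^sub>R z"

lemma clip_eq: "K > 0 \<Longrightarrow> cmod z \<le> K \<Longrightarrow> clip K z = z"
  by (simp add: clip_def max_def)

lemma norm_clip_le: "K > 0 \<Longrightarrow> cmod (clip K z) \<le> K"
  by (auto simp: clip_def max_def field_simps)

lemma norm_minus_clip_le: 
  assumes "K > 0" shows "cmod (z - clip K z) \<le> cmod z"
proof -
  have "z - clip K z = (1 - K / max K (cmod z)) *\<^sub>R z"
    by (simp add: clip_def scaleR_diff_left)
  moreover have "0 \<le> 1 - K / max K (cmod z)" "1 - K / max K (cmod z) \<le> 1"
    using assms by (auto simp: max_def divide_le_eq_1)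
  ultimately show ?thesis
    by (auto intro!: mult_left_le_one_le)
qed

lemma continuous_on_clip [continuous_intros]:
  "K > 0 \<Longrightarrow> continuous_on S f \<Longrightarrow> continuous_on S (\<lambda>x. clip K (f x))"
  unfolding clip_def by (intro continuous_intros) (auto simp: max_def)

lemma borel_measurable_clip [measurable]: "clip K \<in> borel_measurable borel"
  unfolding clip_def[abs_def] by measurable

lemma sq_norm_dominated:
  fixes u :: "nat \<Rightarrow> 'a \<Rightarrow> complex"
  assumes [measurable]: "\<And>n. u n \<in> borel_measurable M" "f \<in> borel_measurable M" "w \<in> borel_measurable M"
    and lim: "AE x in M. (\<lambda>n. u n x) \<longlonglongrightarrow> f x"
    and w: "\<And>n. AE x in M. (cmod (u n x - f x))\<^sup>2 \<le> w x" "(\<integral>\<^sup>+x. ennreal (w x) \<partial>M) < \<infinity>"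
  shows "(\<lambda>n. sq_norm M (\<lambda>x. u n x - f x)) \<longlonglongrightarrow> 0"
proof -
  have "(\<lambda>n. \<integral>\<^sup>+x. ennreal ((cmod (u n x - f x))\<^sup>2) \<partial>M) \<longlonglongrightarrow> (\<integral>\<^sup>+x. 0 \<partial>M)"
  proof (rule nn_integral_dominated_convergence[where w = "\<lambda>x. ennreal (w x)"])
    show "AE x in M. ennreal ((cmod (u n x - f x))\<^sup>2) \<le> ennreal (w x)" for n
      using w(1)[of n] by eventually_elim (rule ennreal_leI)
    show "AE x in M. (\<lambda>n. ennreal ((cmod (u n x - f x))\<^sup>2)) \<longlonglongrightarrow> 0"
      using lim
    proof eventually_elim
      case (elim x)
      then have "(\<lambda>n. ennreal ((cmod (u n x - f x))\<^sup>2)) \<longlonglongrightarrow> ennreal ((cmod (f x - f x))\<^sup>2)"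
        by (intro tendsto_ennrealI tendsto_intros)
      then show ?case by simp
    qed
  qed (use w(2) in \<open>simp_all\<close>)
  then show ?thesis by (simp add: sq_norm_def)
qed

lemma borel_measurable_AE_limit_continuous:
  fixes f :: "real \<Rightarrow> complex"
  assumes "f \<in> borel_measurable borel"
  obtains g where "\<And>n. continuous_on UNIV (g n)" "AE x in lborel. (\<lambda>n. g n x) \<longlonglongrightarrow> f x"
proof -
  have "f \<in> borel_measurable lebesgue" using assms by (simp add: measurable_completion)
  then have "f measurable_on UNIV" by (intro lebesgue_measurable_imp_measurable_on) auto
  then obtain N g where N: "negligible N" "\<And>n::nat. continuous_on UNIV (g n)"
     "\<And>x. x \<notin> N \<Longrightarrow> (\<lambda>n. g n x) \<longlonglongrightarrow> f x"
    by (auto simp: measurable_on_def)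
  have "AE x in lebesgue. (\<lambda>n. g n x) \<longlonglongrightarrow> f x"
    using N by (intro AE_I'[of N]) (auto simp: negligible_iff_null_sets)
  then show ?thesis using N(2) that by (auto simp: AE_completion_iff)
qed

lemma ex_approx_of_tendsto_0:
  fixes h :: "nat \<Rightarrow> ennreal" and e :: real
  assumes "h \<longlonglongrightarrow> 0" "e > 0"
  obtains n where "h n \<le> ennreal e"
proof -
  have "\<forall>\<^sub>F n in sequentially. h n < ennreal e"
    using assms by (intro order_tendstoD(2)[OF assms(1)]) auto
  then obtain n where "h n < ennreal e" by (auto simp: eventually_sequentially)
  then show ?thesis using that[of n] by simp
qed

lemma trig_poly_measurable: "s \<in> trig_poly t \<Longrightarrow> s \<in> borel_measurable borel"
  by (induction rule: trig_poly.induct) auto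

text \<open>Three successive approximations: \<open>f\<close> by a bounded \<open>f1\<close> through clipping, \<open>f1\<close> by a
  continuous function \<open>u n\<close> that vanishes at both ends of the period, and that function uniformly by a
  trigonometric polynomial. The errors \<open>e/8\<close>, \<open>e/16\<close>, \<open>e/16\<close> are weighted by 2, 4, 4.\<close>
lemma trig_poly_dense_L2:
  fixes f :: "real \<Rightarrow> complex"
  assumes t: "t > 0" and [measurable]: "f \<in> borel_measurable borel"
    and fin: "sq_norm (period_measure t a) f < \<infinity>" and "e > 0"
  obtains s where "s \<in> trig_poly t" "sq_norm (period_measure t a) (\<lambda>x. f x - s x) \<le> ennreal e"
proof -
  let ?M = "period_measure t a" and ?b = "a + 2 * pi / t"
  have ab: "a < ?b" using t by simp
  interpret finite_measure ?M by (rule finite_measure_period)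
  have "(\<lambda>n. sq_norm ?M (\<lambda>x. clip (real (Suc n)) (f x) - f x)) \<longlonglongrightarrow> 0"
  proof (rule sq_norm_dominated[where w = "\<lambda>x. (cmod (f x))\<^sup>2"])
    show "AE x in ?M. (\<lambda>n. clip (real (Suc n)) (f x)) \<longlonglongrightarrow> f x"
    proof (rule AE_I2)
      fix x
      obtain n0 where "cmod (f x) \<le> real n0" using real_arch_simple by blast
      then have "\<forall>\<^sub>F n in sequentially. clip (real (Suc n)) (f x) = f x"
        by (intro eventually_sequentiallyI[of n0] clip_eq) auto
      then show "(\<lambda>n. clip (real (Suc n)) (f x)) \<longlonglongrightarrow> f x" by (rule tendsto_eventually)
    qed
    show "AE x in ?M. (cmod (clip (real (Suc n)) (f x) - f x))\<^sup>2 \<le> (cmod (f x))\<^sup>2" for n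
    proof (intro AE_I2 power_mono)
      show "cmod (clip (real (Suc n)) (f x) - f x) \<le> cmod (f x)" for x
        using norm_minus_clip_le[of "real (Suc n)" "f x"] by (simp add: norm_minus_commute)
    qed auto
    show "(\<integral>\<^sup>+x. ennreal ((cmod (f x))\<^sup>2) \<partial>?M) < \<infinity>" using fin by (simp add: sq_norm_def)
  qed (rule borel_measurable_period; measurable)+
  then obtain k where k: "sq_norm ?M (\<lambda>x. clip (real (Suc k)) (f x) - f x) \<le> ennreal (e / 8)"
    by (rule ex_approx_of_tendsto_0[where e = "e/8"]) (use \<open>e > 0\<close> in simp, blast)
  define K where "K = real (Suc k)"
  have K: "K > 0" by (simp add: K_def)
  define f1 where "f1 x = clip K (f x)" for x
  have [measurable]: "f1 \<in> borel_measurable borel" unfolding f1_def[abs_def] by measurable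
  obtain g where g: "\<And>n. continuous_on UNIV (g n)" "AE x in lborel. (\<lambda>n. g n x) \<longlonglongrightarrow> f1 x"
    using borel_measurable_AE_limit_continuous[of f1] by auto
  \<comment> \<open>\<open>\<theta> n\<close> vanishes at both end points and tends to 1 in between, which makes \<open>u n\<close> periodic.\<close>
  define \<theta> where "\<theta> n x = min 1 (real n * (x - a)) * min 1 (real n * (?b - x))" for n :: nat and x
  define u where "u n x = \<theta> n x *\<^sub>R clip K (g n x)" for n x
  have \<theta>01: "0 \<le> \<theta> n x \<and> \<theta> n x \<le> 1" if "x \<in> {a..<?b}" for n x
    using that by (auto simp: \<theta>_def intro!: mult_nonneg_nonneg mult_le_one)
  have \<theta>lim: "(\<lambda>n. \<theta> n x) \<longlonglongrightarrow> 1" if "x \<in> {a<..<?b}" for x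
  proof -
    have ev: "\<forall>\<^sub>F n in sequentially. min 1 (real n * y) = 1" if "y > 0" for y
    proof -
      obtain n0 where "1 < real n0 * y" using \<open>y > 0\<close> reals_Archimedean3 by blast
      then show ?thesis using \<open>y > 0\<close>
        by (intro eventually_sequentiallyI[of n0])
           (auto simp: min_def intro: order_trans[OF less_imp_le mult_right_mono])
    qed
    have "\<forall>\<^sub>F n in sequentially. \<theta> n x = 1"
      using ev[of "x - a"] ev[of "?b - x"] that unfolding \<theta>_def
      by (auto elim: eventually_elim2)
    then show ?thesis by (rule tendsto_eventually)
  qed
  have ucont: "continuous_on S (u n)" for n S
    unfolding u_def[abs_def] \<theta>_def
    by (intro continuous_intros K continuous_on_subset[OF g(1)]) auto
  have [measurable]: "u n \<in> borel_measurable borel" for n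
    by (intro borel_measurable_continuous_onI ucont)
  have "(\<lambda>n. sq_norm ?M (\<lambda>x. u n x - f1 x)) \<longlonglongrightarrow> 0"
  proof (rule sq_norm_dominated[where w = "\<lambda>x. (K + K)\<^sup>2"])
    have "AE x in lborel. x \<in> {a..<?b} \<longrightarrow> (\<lambda>n. u n x) \<longlonglongrightarrow> f1 x"
      using g(2) AE_lborel_singleton[of a]
    proof eventually_elim
      case (elim x)
      show ?case
      proof
        assume "x \<in> {a..<?b}"
        then have "x \<in> {a<..<?b}" using elim by auto
        have "continuous_on UNIV (clip K)" using continuous_on_clip[OF K continuous_on_id] by simp
        then have "isCont (clip K) (f1 x)" by (simp add: continuous_on_eq_continuous_at)
        then have "(\<lambda>n. clip K (g n x)) \<longlonglongrightarrow> clip K (f1 x)"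
          using elim by (intro isCont_tendsto_compose[of _ "clip K"]) auto
        then have "(\<lambda>n. u n x) \<longlonglongrightarrow> 1 *\<^sub>R clip K (f1 x)"
          unfolding u_def using \<open>x \<in> {a<..<?b}\<close> by (intro tendsto_intros \<theta>lim)
        moreover have "clip K (f1 x) = f1 x"
          using K norm_clip_le[of K "f x"] by (intro clip_eq) (auto simp: f1_def)
        ultimately show "(\<lambda>n. u n x) \<longlonglongrightarrow> f1 x" by simp
      qed
    qed
    then show "AE x in ?M. (\<lambda>n. u n x) \<longlonglongrightarrow> f1 x"
      by (subst AE_restrict_space_iff) auto
    show "AE x in ?M. (cmod (u n x - f1 x))\<^sup>2 \<le> (K + K)\<^sup>2" for n
    proof (rule AE_I2)
      fix x assume "x \<in> space ?M"
      then have "x \<in> {a..<?b}" by (simp add: space_restrict_space)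
      have "cmod (u n x) \<le> 1 * K"
        using \<theta>01[OF \<open>x \<in> {a..<?b}\<close>, of n] norm_clip_le[OF K, of "g n x"]
        unfolding u_def norm_scaleR by (intro mult_mono) auto
      then have "cmod (u n x - f1 x) \<le> K + K"
        using norm_clip_le[OF K, of "f x"] by (intro norm_triangle_le_diff) (auto simp: f1_def)
      then show "(cmod (u n x - f1 x))\<^sup>2 \<le> (K + K)\<^sup>2" by (intro power_mono) auto
    qed
    show "(\<integral>\<^sup>+x. ennreal ((K + K)\<^sup>2) \<partial>?M) < \<infinity>"
      using emeasure_finite[of "space ?M"]
      by (simp add: ennreal_mult_eq_top_iff less_top[symmetric])
  qed (rule borel_measurable_period; measurable)+
  then obtain n where n: "sq_norm ?M (\<lambda>x. u n x - f1 x) \<le> ennreal (e / 16)"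
    by (rule ex_approx_of_tendsto_0[where e = "e/16"]) (use \<open>e > 0\<close> in simp, blast)
  define m where "m = measure ?M (space ?M) + 1"
  have m: "m > 0" "emeasure ?M (space ?M) \<le> ennreal m"
    by (auto simp: m_def emeasure_eq_measure intro!: add_nonneg_pos ennreal_leI)
  obtain s where s: "s \<in> trig_poly t" "\<And>x. x \<in> {a..?b} \<Longrightarrow> cmod (u n x - s x) < sqrt (e / 16 / m)"
  proof (rule trig_poly_uniformly_dense[OF t ucont[of "{a..?b}" n], of "sqrt (e / 16 / m)"])
    show "u n a = u n ?b" by (simp add: u_def \<theta>_def)
    show "0 < sqrt (e / 16 / m)" using \<open>e > 0\<close> m by simp
  qed blast
  note [measurable] = trig_poly_measurable[OF s(1)]
  have "sq_norm ?M (\<lambda>x. u n x - s x) \<le> (\<integral>\<^sup>+x. ennreal (e / 16 / m) \<partial>?M)"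
    unfolding sq_norm_def
  proof (intro nn_integral_mono ennreal_leI)
    fix x assume "x \<in> space ?M"
    then have "cmod (u n x - s x) \<le> sqrt (e / 16 / m)"
      using s(2)[of x] by (auto simp: space_restrict_space)
    then have "(cmod (u n x - s x))\<^sup>2 \<le> (sqrt (e / 16 / m))\<^sup>2" by (intro power_mono) auto
    then show "(cmod (u n x - s x))\<^sup>2 \<le> e / 16 / m" using \<open>e > 0\<close> m by simp
  qed
  also have "\<dots> = ennreal (e / 16 / m) * emeasure ?M (space ?M)" by simp
  also have "\<dots> \<le> ennreal (e / 16 / m) * ennreal m" by (intro mult_left_mono m) auto
  also have "\<dots> = ennreal (e / 16)" using m \<open>e > 0\<close> by (subst ennreal_mult[symmetric]) auto
  finally have us: "sq_norm ?M (\<lambda>x. u n x - s x) \<le> ennreal (e / 16)" .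
  have "sq_norm ?M (\<lambda>x. f x - s x) \<le> 2 * sq_norm ?M (\<lambda>x. f x - f1 x) + 2 * sq_norm ?M (\<lambda>x. f1 x - s x)"
    by (rule sq_norm_diff_le; rule borel_measurable_period; measurable)
  also have "\<dots> \<le> 2 * sq_norm ?M (\<lambda>x. f x - f1 x) + 2 * (2 * sq_norm ?M (\<lambda>x. f1 x - u n x) + 2 * sq_norm ?M (\<lambda>x. u n x - s x))"
    by (intro add_mono mult_left_mono order_refl sq_norm_diff_le borel_measurable_period) auto
  also have "\<dots> \<le> 2 * ennreal (e / 8) + 2 * (2 * ennreal (e / 16) + 2 * ennreal (e / 16))"
    using k[folded K_def, folded f1_def, unfolded sq_norm_minus_commute[of _ f1 f]]
      n[unfolded sq_norm_minus_commute[of _ "u n" f1]] us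
    by (intro add_mono mult_left_mono order_refl) auto
  also have "\<dots> \<le> ennreal e"
  proof -
    have double: "2 * ennreal y = ennreal (2 * y)" if "y \<ge> 0" for y
      using that by (simp add: ennreal_mult)
    show ?thesis
      using \<open>e > 0\<close> by (simp add: double ennreal_plus[symmetric] del: ennreal_plus)
  qed
  finally show ?thesis using that s(1) by blast
qed


lemma integral_trig_poly_norm:
  assumes t: "t > 0" and "finite N"
  shows "(\<integral>x. (cmod (\<Sum>n\<in>N. d n * mode t n x))\<^sup>2 \<partial>period_measure t a) = 2 * pi / t * (\<Sum>n\<in>N. (cmod (d n))\<^sup>2)"
proof -
  let ?M = "period_measure t a"
  interpret finite_measure ?M by (rule finite_measure_period)
  have int: "integrable ?M (mode t n)" for n
    by (rule integrable_const_bound[where B = 1]) (auto intro: borel_measurable_period)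
  have "complex_of_real (\<integral>x. (cmod (\<Sum>n\<in>N. d n * mode t n x))\<^sup>2 \<partial>?M)
      = (\<integral>x. complex_of_real ((cmod (\<Sum>n\<in>N. d n * mode t n x))\<^sup>2) \<partial>?M)"
    by (rule integral_complex_of_real[symmetric])
  also have "\<dots> = (\<integral>x. (\<Sum>n\<in>N. \<Sum>m\<in>N. d n * cnj (d m) * mode t (n - m) x) \<partial>?M)"
    unfolding complex_norm_square
    by (intro Bochner_Integration.integral_cong refl)
       (simp add: sum_product mode_mult_cnj[symmetric] mult_ac)
  also have "\<dots> = (\<Sum>n\<in>N. \<Sum>m\<in>N. d n * cnj (d m) * (\<integral>x. mode t (n - m) x \<partial>?M))"
    using int by (simp add: Bochner_Integration.integral_sum)
  also have "\<dots> = (\<Sum>n\<in>N. \<Sum>m\<in>N. if n = m then d n * cnj (d m) * (2 * pi / t) else 0)"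
    by (intro sum.cong refl) (simp add: integral_mode[OF t])
  also have "\<dots> = (\<Sum>n\<in>N. d n * cnj (d n) * (2 * pi / t))"
    using \<open>finite N\<close> by simp
  also have "\<dots> = complex_of_real (2 * pi / t * (\<Sum>n\<in>N. (cmod (d n))\<^sup>2))"
    unfolding of_real_mult of_real_sum complex_norm_square by (simp add: sum_distrib_left sum_divide_distrib mult_ac)
  finally show ?thesis by (simp only: of_real_eq_iff)
qed

text \<open>Expanding the square; completing it in the coefficients \<open>d\<close> shows that the Fourier
  coefficients divided by the period length give the best approximation.\<close>
lemma trig_poly_distance:
  assumes t: "t > 0" and [measurable]: "f \<in> borel_measurable borel"
    and fin: "sq_norm (period_measure t a) f < \<infinity>" and N: "finite N"
    and c: "\<And>n. c n = (\<integral>x. f x * cnj (mode t n x) \<partial>period_measure t a)"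
  shows "(\<integral>x. (cmod (f x - (\<Sum>n\<in>N. d n * mode t n x)))\<^sup>2 \<partial>period_measure t a)
    = (\<integral>x. (cmod (f x))\<^sup>2 \<partial>period_measure t a) - 2 * Re (\<Sum>n\<in>N. cnj (d n) * c n)
      + 2 * pi / t * (\<Sum>n\<in>N. (cmod (d n))\<^sup>2)"
proof -
  let ?M = "period_measure t a"
  define s where "s x = (\<Sum>n\<in>N. d n * mode t n x)" for x
  interpret finite_measure ?M by (rule finite_measure_period)
  have fM: "f \<in> borel_measurable ?M" by (rule borel_measurable_period) measurable
  have [measurable]: "s \<in> borel_measurable borel" unfolding s_def[abs_def] by measurable
  have f1: "integrable ?M f" and f2: "integrable ?M (\<lambda>x. (cmod (f x))\<^sup>2)"
    using L2_finite_measure_integrable[OF finite_measure_period fM fin] sq_norm_integrable(1)[OF fM fin] by auto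
  have s2: "integrable ?M (\<lambda>x. (cmod (s x))\<^sup>2)"
  proof (rule integrable_const_bound[where B = "(\<Sum>n\<in>N. cmod (d n))\<^sup>2"])
    have "cmod (s x) \<le> (\<Sum>n\<in>N. cmod (d n))" for x
      unfolding s_def by (rule order_trans[OF norm_sum]) (simp add: norm_mult)
    then show "AE x in ?M. norm ((cmod (s x))\<^sup>2) \<le> (\<Sum>n\<in>N. cmod (d n))\<^sup>2"
      by (intro AE_I2) (simp add: power_mono)
  qed (rule borel_measurable_period; measurable)
  have fm: "integrable ?M (\<lambda>x. f x * cnj (mode t n x))" for n
    by (rule Bochner_Integration.integrable_bound[OF f1])
       (auto simp: norm_mult cnj_mode intro!: borel_measurable_period)
  have fs: "f x * cnj (s x) = (\<Sum>n\<in>N. cnj (d n) * (f x * cnj (mode t n x)))" for x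
    by (simp add: s_def sum_distrib_left mult_ac)
  have fs1: "integrable ?M (\<lambda>x. f x * cnj (s x))"
    unfolding fs using fm by auto
  have "(\<integral>x. (cmod (f x - s x))\<^sup>2 \<partial>?M) = (\<integral>x. ((cmod (f x))\<^sup>2 - 2 * Re (f x * cnj (s x)) + (cmod (s x))\<^sup>2) \<partial>?M)"
    by (intro Bochner_Integration.integral_cong refl, unfold cmod_power2) (simp add: power2_eq_square algebra_simps)
  also have "\<dots> = (\<integral>x. (cmod (f x))\<^sup>2 \<partial>?M) - 2 * (\<integral>x. Re (f x * cnj (s x)) \<partial>?M) + (\<integral>x. (cmod (s x))\<^sup>2 \<partial>?M)"
    using f2 s2 fs1 by (subst Bochner_Integration.integral_add) (auto simp del: times_complex.sel)
  also have "(\<integral>x. Re (f x * cnj (s x)) \<partial>?M) = Re (\<integral>x. f x * cnj (s x) \<partial>?M)"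
    using fs1 by (rule integral_Re)
  also have "(\<integral>x. f x * cnj (s x) \<partial>?M) = (\<Sum>n\<in>N. cnj (d n) * c n)"
    unfolding fs c using fm by (simp add: Bochner_Integration.integral_sum)
  also have "(\<integral>x. (cmod (s x))\<^sup>2 \<partial>?M) = 2 * pi / t * (\<Sum>n\<in>N. (cmod (d n))\<^sup>2)"
    unfolding s_def by (rule integral_trig_poly_norm[OF t N])
  finally show ?thesis unfolding s_def .
qed

text \<open>Bessel's inequality bounds the sum from above. For the reverse, the distance from \<open>f\<close> to
  any trigonometric polynomial is at least the Bessel defect, and by density it can be made small.\<close>
lemma parseval:
  assumes t: "t > 0" and [measurable]: "f \<in> borel_measurable borel"
    and fin: "sq_norm (period_measure t a) f < \<infinity>"
    and c: "\<And>n. c n = (\<integral>x. f x * cnj (mode t n x) \<partial>period_measure t a)"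
  shows "((\<lambda>n. (cmod (c n))\<^sup>2) has_sum (2 * pi / t * (\<integral>x. (cmod (f x))\<^sup>2 \<partial>period_measure t a))) UNIV"
proof -
  let ?M = "period_measure t a"
  define p where "p = 2 * pi / t"
  define P where "P = (\<integral>x. (cmod (f x))\<^sup>2 \<partial>?M)"
  have p: "p > 0" using t by (simp add: p_def)
  have dist: "(\<integral>x. (cmod (f x - (\<Sum>n\<in>N. d n * mode t n x)))\<^sup>2 \<partial>?M)
      = P - 2 * Re (\<Sum>n\<in>N. cnj (d n) * c n) + p * (\<Sum>n\<in>N. (cmod (d n))\<^sup>2)" if "finite N" for N d
    unfolding P_def p_def by (rule trig_poly_distance[OF t assms(2) fin that c])
  have bessel: "(\<Sum>n\<in>N. (cmod (c n))\<^sup>2) \<le> p * P" if "finite N" for N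
  proof -
    have "0 \<le> (\<integral>x. (cmod (f x - (\<Sum>n\<in>N. c n / p * mode t n x)))\<^sup>2 \<partial>?M)" by simp
    also have "\<dots> = P - 2 * Re (\<Sum>n\<in>N. cnj (c n / p) * c n) + p * (\<Sum>n\<in>N. (cmod (c n / p))\<^sup>2)"
      by (rule dist) fact
    also have "(\<Sum>n\<in>N. cnj (c n / p) * c n) = complex_of_real ((\<Sum>n\<in>N. (cmod (c n))\<^sup>2) / p)"
      unfolding of_real_divide of_real_sum complex_norm_square by (simp add: sum_divide_distrib mult_ac)
    also have "(\<Sum>n\<in>N. (cmod (c n / p))\<^sup>2) = (\<Sum>n\<in>N. (cmod (c n))\<^sup>2) / p\<^sup>2"
      using p by (simp add: norm_divide power_divide sum_divide_distrib)
    finally have "0 \<le> P - (\<Sum>n\<in>N. (cmod (c n))\<^sup>2) / p"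
      using p by (simp add: power2_eq_square)
    then show ?thesis using p by (simp add: field_simps)
  qed
  then have sum: "(\<lambda>n. (cmod (c n))\<^sup>2) summable_on UNIV"
    by (intro nonneg_bdd_above_summable_on) (auto intro!: bdd_aboveI[where M = "p * P"])
  have "p * P \<le> (\<Sum>\<^sub>\<infinity>n. (cmod (c n))\<^sup>2)"
  proof (rule field_le_epsilon)
    fix e :: real assume "e > 0"
    then have "e / p > 0" using p by simp
    then obtain s where s: "s \<in> trig_poly t" "sq_norm ?M (\<lambda>x. f x - s x) \<le> ennreal (e / p)"
      using trig_poly_dense_L2[OF t assms(2) fin] by blast
    obtain N d where N: "finite N" and sd: "s = (\<lambda>x. \<Sum>n\<in>N. d n * mode t n x)"
      using trig_poly_expansion[OF s(1)] by blast
    note [measurable] = trig_poly_measurable[OF s(1)]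
    have m: "(\<lambda>x. f x - s x) \<in> borel_measurable ?M"
      by (rule borel_measurable_period) measurable
    have "sq_norm ?M (\<lambda>x. f x - s x) < \<infinity>" using s(2) by (rule order.strict_trans1) simp
    from sq_norm_integrable(2)[OF m this] s(2)
    have "(\<integral>x. (cmod (f x - s x))\<^sup>2 \<partial>?M) \<le> e / p"
      using \<open>e / p > 0\<close> by simp
    also have "(\<integral>x. (cmod (f x - s x))\<^sup>2 \<partial>?M) = P - 2 * Re (\<Sum>n\<in>N. cnj (d n) * c n) + p * (\<Sum>n\<in>N. (cmod (d n))\<^sup>2)"
      unfolding sd by (rule dist) fact
    finally have 1: "P \<le> e / p + (\<Sum>n\<in>N. 2 * Re (cnj (d n) * c n) - p * (cmod (d n))\<^sup>2)"
      by (simp add: sum_subtractf sum_distrib_left)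
    have "2 * Re (cnj (d n) * c n) - p * (cmod (d n))\<^sup>2 \<le> (cmod (c n))\<^sup>2 / p" for n
    proof -
      have "0 \<le> (cmod (p * d n - c n))\<^sup>2 / p" using p by simp
      also have "\<dots> = p * (cmod (d n))\<^sup>2 - 2 * Re (cnj (d n) * c n) + (cmod (c n))\<^sup>2 / p"
        using p unfolding cmod_power2 by (simp add: power2_eq_square field_simps)
      finally show ?thesis by simp
    qed
    then have "P \<le> e / p + (\<Sum>n\<in>N. (cmod (c n))\<^sup>2 / p)"
      using 1 by (meson add_left_mono order_trans sum_mono)
    also have "\<dots> = (e + (\<Sum>n\<in>N. (cmod (c n))\<^sup>2)) / p"
      by (simp add: sum_divide_distrib add_divide_distrib)
    finally have "p * P \<le> e + (\<Sum>n\<in>N. (cmod (c n))\<^sup>2)"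
      using p by (simp add: field_simps)
    also have "(\<Sum>n\<in>N. (cmod (c n))\<^sup>2) \<le> (\<Sum>\<^sub>\<infinity>n. (cmod (c n))\<^sup>2)"
      using sum N by (intro finite_sum_le_infsum) auto
    finally show "p * P \<le> (\<Sum>\<^sub>\<infinity>n. (cmod (c n))\<^sup>2) + e" by simp
  qed
  moreover have "(\<Sum>\<^sub>\<infinity>n. (cmod (c n))\<^sup>2) \<le> p * P"
    using sum bessel by (intro infsum_le_finite_sums) auto
  ultimately show ?thesis
    using has_sum_infsum[OF sum] by (simp add: p_def P_def)
qed

section \<open>Plancherel's theorem and the \<open>L\<^sup>2\<close> Fourier transform\<close>
definition fourier_integral :: "(real \<Rightarrow> complex) \<Rightarrow> real \<Rightarrow> complex" where
  "fourier_integral h \<xi> = complex_of_real (1 / sqrt (2 * pi)) * (LINT t|lborel. h t * exp (- (\<i> * complex_of_real (t * \<xi>))))"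

definition L2_compact_support :: "(real \<Rightarrow> complex) set" where
  "L2_compact_support = {h \<in> L2. \<exists>R. \<forall>x. x \<notin> {-R..R} \<longrightarrow> h x = 0}"

text \<open>The centre \<open>a\<close> is a parameter because a translation moves the window \<open>[-R, R]\<close> in the
  definition of the Fourier transform to a window centred elsewhere.\<close>
definition cutoff :: "real \<Rightarrow> real \<Rightarrow> (real \<Rightarrow> complex) \<Rightarrow> real \<Rightarrow> complex" where
  "cutoff a R f x = indicator {a - R..a + R} x * f x"

lemma fourier_truncated_fourier_integral: "fourier_truncated R f = fourier_integral (cutoff 0 R f)"
  by (auto simp: fourier_truncated_def fourier_integral_def cutoff_def set_lebesgue_integral_def scaleR_conv_of_real
      fun_eq_iff indicator_def intro!: Bochner_Integration.integral_cong)

lemma cutoff_compact_support: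
  assumes "f \<in> L2" shows "cutoff a R f \<in> L2_compact_support"
proof -
  have "(\<lambda>x. indicator {a - R..a + R} x * f x) \<in> L2"
    using assms by (intro L2_bounded_mult[where B = 1]) (auto simp: indicator_def)
  moreover have "indicator {a - R..a + R} x * f x = 0" if "x \<notin> {- (\<bar>a\<bar> + \<bar>R\<bar>)..\<bar>a\<bar> + \<bar>R\<bar>}" for x
    using that by (auto simp: indicator_def)
  ultimately show ?thesis unfolding L2_compact_support_def cutoff_def by blast
qed

lemma L2_compact_support_L2: "h \<in> L2_compact_support \<Longrightarrow> h \<in> L2"
  by (simp add: L2_compact_support_def)

lemma L2_compact_support_diff:
  assumes "h \<in> L2_compact_support" "k \<in> L2_compact_support"
  shows "(\<lambda>x. h x - k x) \<in> L2_compact_support"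
proof -
  obtain R S where RS: "\<And>x. x \<notin> {-R..R} \<Longrightarrow> h x = 0" "\<And>x. x \<notin> {-S..S} \<Longrightarrow> k x = 0"
    using assms by (auto simp: L2_compact_support_def)
  have "h x - k x = 0" if "x \<notin> {- max R S..max R S}" for x
    using that by (subst RS(1), force, subst RS(2), force, simp)
  then show ?thesis
    using assms L2_diff unfolding L2_compact_support_def by blast
qed

lemma L2_compact_support_integrable:
  assumes "h \<in> L2_compact_support" and [measurable]: "m \<in> borel_measurable borel" and m: "\<And>x. cmod (m x) \<le> 1"
  shows "integrable lborel (\<lambda>x. h x * m x)"
proof -
  obtain R where R: "\<And>x. x \<notin> {-R..R} \<Longrightarrow> h x = 0" and "h \<in> L2"
    using assms by (auto simp: L2_compact_support_def)
  then have [measurable]: "h \<in> borel_measurable borel" and fin: "sq_norm lborel h < \<infinity>" by (auto simp: L2_iff)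
  show ?thesis
  proof (rule Bochner_Integration.integrable_bound)
    show "integrable lborel (\<lambda>x. indicator {-R..R} x + (cmod (h x))\<^sup>2 :: real)"
      using sq_norm_integrable(1)[OF _ fin] by (intro Bochner_Integration.integrable_add integrable_real_indicator) (auto simp: emeasure_lborel_Icc_eq)
    have r: "r \<le> 1 + r\<^sup>2" for r :: real
      using zero_le_power2[of "r - 1/2"] by (simp add: power2_eq_square field_simps)
    have "cmod (h x * m x) \<le> indicator {-R..R} x + (cmod (h x))\<^sup>2" for x
    proof -
      have "cmod (h x * m x) \<le> cmod (h x)" using m[of x] by (simp add: norm_mult mult_left_le)
      also have "\<dots> \<le> indicator {-R..R} x + (cmod (h x))\<^sup>2"
        using r[of "cmod (h x)"] R[of x] by (cases "x \<in> {-R..R}") auto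
      finally show ?thesis .
    qed
    then show "AE x in lborel. norm (h x * m x) \<le> norm (indicator {-R..R} x + (cmod (h x))\<^sup>2 :: real)"
      by (auto intro: order_trans[OF _ abs_ge_self])
  qed measurable
qed

lemma fourier_integral_add_cmult:
  assumes "h \<in> L2_compact_support" "k \<in> L2_compact_support"
  shows "fourier_integral (\<lambda>x. h x + c * k x) \<xi> = fourier_integral h \<xi> + c * fourier_integral k \<xi>"
proof -
  have "integrable lborel (\<lambda>t. f t * exp (- (\<i> * complex_of_real (t * \<xi>))))" if "f \<in> L2_compact_support" for f
    using that by (rule L2_compact_support_integrable) auto
  then show ?thesis
    using assms by (simp add: fourier_integral_def distrib_right distrib_left mult.assoc)
qed

lemma fourier_integral_diff:
  assumes "h \<in> L2_compact_support" "k \<in> L2_compact_support"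
  shows "fourier_integral (\<lambda>x. h x - k x) \<xi> = fourier_integral h \<xi> - fourier_integral k \<xi>"
  using fourier_integral_add_cmult[OF assms, of "-1"] by simp

lemma borel_measurable_fourier_integral [measurable]:
  assumes [measurable]: "h \<in> borel_measurable borel" shows "fourier_integral h \<in> borel_measurable borel"
  unfolding fourier_integral_def[abs_def] by measurable

lemma nn_integral_count_space_has_sum:
  fixes f :: "'a \<Rightarrow> real"
  assumes "(f has_sum s) A" "\<And>x. x \<in> A \<Longrightarrow> f x \<ge> 0"
  shows "(\<integral>\<^sup>+x. ennreal (f x) \<partial>count_space A) = ennreal s"
proof -
  have "(\<lambda>x. norm (f x)) summable_on A"
    using assms by (subst summable_on_cong[of _ _ f]) (auto intro: has_sum_imp_summable)
  then have a: "Infinite_Set_Sum.abs_summable_on f A" by (simp only: abs_summable_equivalent[symmetric])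
  have "(\<integral>\<^sup>+x. ennreal (f x) \<partial>count_space A) = ennreal (infsetsum f A)"
    using a assms(2) by (rule nn_integral_conv_infsetsum)
  also have "infsetsum f A = s"
    using infsetsum_infsum[OF a] infsumI[OF assms(1)] by simp
  finally show ?thesis .
qed

text \<open>The half-open cells \<open>[nt, nt + t)\<close> tile the line; each is moved to \<open>[0, t)\<close>.\<close>
lemma nn_integral_periodization:
  fixes t :: real
  assumes t: "t > 0" and [measurable]: "G \<in> borel_measurable borel"
  shows "(\<integral>\<^sup>+x. G x \<partial>lborel) =
    (\<integral>\<^sup>+s. (\<integral>\<^sup>+n. G (s + of_int n * t) \<partial>count_space (UNIV :: int set)) * indicator {0..<t} s \<partial>lborel)"
proof -
  have cell: "x \<in> {of_int n * t..<of_int n * t + t} \<longleftrightarrow> n = \<lfloor>x / t\<rfloor>" for x and n :: int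
  proof -
    have "x \<in> {of_int n * t..<of_int n * t + t} \<longleftrightarrow> of_int n \<le> x / t \<and> x / t < of_int n + 1"
      using t by (simp add: field_simps)
    also have "\<dots> \<longleftrightarrow> \<lfloor>x / t\<rfloor> = n" by (simp only: floor_eq_iff)
    finally show ?thesis by auto
  qed
  have "(\<integral>\<^sup>+x. G x \<partial>lborel) =
      (\<integral>\<^sup>+x. (\<integral>\<^sup>+n. G x * indicator {of_int n * t..<of_int n * t + t} x \<partial>count_space (UNIV :: int set)) \<partial>lborel)"
  proof (rule nn_integral_cong)
    fix x
    have "(\<integral>\<^sup>+n. G x * indicator {of_int n * t..<of_int n * t + t} x \<partial>count_space (UNIV :: int set))
        = (\<Sum>n\<in>{\<lfloor>x / t\<rfloor>}. G x * indicator {of_int n * t..<of_int n * t + t} x)"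
      using cell[of x] by (intro nn_integral_count_space') (auto simp: indicator_def simp del: atLeastLessThan_iff)
    also have "\<dots> = G x" using cell[of x] by (simp del: atLeastLessThan_iff)
    finally show "G x = (\<integral>\<^sup>+n. G x * indicator {of_int n * t..<of_int n * t + t} x \<partial>count_space (UNIV :: int set))" ..
  qed
  also have "\<dots> = (\<integral>\<^sup>+n. (\<integral>\<^sup>+x. G x * indicator {of_int n * t..<of_int n * t + t} x \<partial>lborel) \<partial>count_space (UNIV :: int set))"
    by (intro nn_integral_count_space_nn_integral) auto
  also have "\<dots> = (\<integral>\<^sup>+n. (\<integral>\<^sup>+s. G (s + of_int n * t) * indicator {0..<t} s \<partial>lborel) \<partial>count_space (UNIV :: int set))"
  proof (rule nn_integral_cong)
    fix n :: int
    show "(\<integral>\<^sup>+x. G x * indicator {of_int n * t..<of_int n * t + t} x \<partial>lborel) =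
        (\<integral>\<^sup>+s. G (s + of_int n * t) * indicator {0..<t} s \<partial>lborel)"
      by (subst nn_integral_real_affine[where c = 1 and t = "of_int n * t"])
         (auto intro!: nn_integral_cong simp: indicator_def add.commute)
  qed
  also have "\<dots> = (\<integral>\<^sup>+s. (\<integral>\<^sup>+n. G (s + of_int n * t) * indicator {0..<t} s \<partial>count_space (UNIV :: int set)) \<partial>lborel)"
    by (intro nn_integral_count_space_nn_integral[symmetric]) auto
  also have "\<dots> = (\<integral>\<^sup>+s. (\<integral>\<^sup>+n. G (s + of_int n * t) \<partial>count_space (UNIV :: int set)) * indicator {0..<t} s \<partial>lborel)"
    by (intro nn_integral_cong nn_integral_multc) auto
  finally show ?thesis .
qed

text \<open>Choose \<open>t\<close> so small that one period \<open>2\<pi>/t\<close> contains the support of \<open>h\<close>. Up to the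
  factor \<open>sqrt (2\<pi>)\<close>, the values of the transform at \<open>s + nt\<close> are the Fourier coefficients of
  \<open>h(x) e\<^bsup>-isx\<^esup>\<close> over that period, so by Parseval their square sum does not depend on \<open>s\<close>.
  Integrating over \<open>s \<in> [0, t)\<close> gives the norm of the whole transform.\<close>
lemma plancherel_compact_support:
  assumes h: "h \<in> L2_compact_support"
  shows "sq_norm lborel (fourier_integral h) = sq_norm lborel h"
proof -
  obtain R where R: "\<And>x. x \<notin> {-R..R} \<Longrightarrow> h x = 0" and "h \<in> L2"
    using h by (auto simp: L2_compact_support_def)
  then have [measurable]: "h \<in> borel_measurable borel" and fin: "sq_norm lborel h < \<infinity>" by (auto simp: L2_iff)
  define t where "t = pi / (\<bar>R\<bar> + 1)"
  define a where "a = - (\<bar>R\<bar> + 1)"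
  have t: "t > 0" by (simp add: t_def add_nonneg_pos)
  have I: "{a..<a + 2 * pi / t} = {- (\<bar>R\<bar> + 1)..<\<bar>R\<bar> + 1}"
    by (simp add: a_def t_def)
  have supp: "indicator {a..<a + 2 * pi / t} x *\<^sub>R h x = h x" for x
    using R[of x] unfolding I by (cases "x \<in> {-R..R}") (auto simp: indicator_def)
  have h0: "h x = 0" if "\<not> (a \<le> x \<and> x < a + 2 * pi / t)" for x
    using supp[of x] that by (auto simp: indicator_def)
  let ?M = "period_measure t a"
  have samples: "(\<integral>\<^sup>+n. ennreal ((cmod (fourier_integral h (s + of_int n * t)))\<^sup>2) \<partial>count_space (UNIV :: int set))
       = ennreal (1 / t) * sq_norm lborel h" for s
  proof -
    define f where "f x = h x * cis (- (s * x))" for x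
    have [measurable]: "f \<in> borel_measurable borel" 
      unfolding f_def[abs_def] cis_conv_exp by measurable
    have nf: "cmod (f x) = cmod (h x)" for x by (simp add: f_def norm_mult)
    have f0: "f x = 0" if "x \<notin> {a..<a + 2 * pi / t}" for x
      using supp[of x] that by (auto simp: f_def)
    have "sq_norm ?M f = sq_norm lborel h"
      unfolding sq_norm_def nf
      by (subst nn_integral_restrict_space)
         (auto intro!: nn_integral_cong simp: indicator_def h0)
    then have fin': "sq_norm ?M f < \<infinity>" using fin by simp
    have int_f: "(\<integral>x. (cmod (f x))\<^sup>2 \<partial>?M) = (\<integral>x. (cmod (h x))\<^sup>2 \<partial>lborel)"
      unfolding nf
      by (subst integral_restrict_space)
         (auto intro!: Bochner_Integration.integral_cong simp: indicator_def dest: contrapos_np[OF _ h0])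
    define c where "c n = (\<integral>x. f x * cnj (mode t n x) \<partial>?M)" for n
    have c: "c n = complex_of_real (sqrt (2 * pi)) * fourier_integral h (s + of_int n * t)" for n
    proof -
      have "c n = (\<integral>x. indicator {a..<a + 2 * pi / t} x *\<^sub>R (f x * cnj (mode t n x)) \<partial>lborel)"
        unfolding c_def by (subst integral_restrict_space) auto
      also have "\<dots> = (\<integral>x. h x * exp (- (\<i> * complex_of_real (x * (s + of_int n * t)))) \<partial>lborel)"
      proof (intro Bochner_Integration.integral_cong refl)
        fix x
        have "indicator {a..<a + 2 * pi / t} x *\<^sub>R (f x * cnj (mode t n x)) = f x * cnj (mode t n x)"
          using f0[of x] by (auto simp: indicator_def)
        also have "\<dots> = h x * cis (- (x * (s + of_int n * t)))"
          by (simp only: f_def mode_def cis_cnj mult.assoc cis_mult) (simp only: algebra_simps minus_add_distrib)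
        finally show "indicator {a..<a + 2 * pi / t} x *\<^sub>R (f x * cnj (mode t n x)) =
            h x * exp (- (\<i> * complex_of_real (x * (s + of_int n * t))))"
          by (simp add: cis_conv_exp)
      qed
      also have "\<dots> = complex_of_real (sqrt (2 * pi)) * fourier_integral h (s + of_int n * t)"
        by (simp add: fourier_integral_def mult.assoc[symmetric] flip: of_real_mult)
      finally show ?thesis .
    qed
    have "((\<lambda>n. (cmod (c n))\<^sup>2) has_sum (2 * pi / t * (\<integral>x. (cmod (f x))\<^sup>2 \<partial>?M))) UNIV"
      by (rule parseval[OF t _ fin' c_def]) measurable
    then have "((\<lambda>n. 1 / (2 * pi) * (cmod (c n))\<^sup>2) has_sum (1 / (2 * pi) * (2 * pi / t * (\<integral>x. (cmod (f x))\<^sup>2 \<partial>?M)))) UNIV"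
      by (rule has_sum_cmult_right)
    moreover have "1 / (2 * pi) * (cmod (c n))\<^sup>2 = (cmod (fourier_integral h (s + of_int n * t)))\<^sup>2" for n
      by (simp add: c norm_mult power_mult_distrib)
    ultimately have "((\<lambda>n. (cmod (fourier_integral h (s + of_int n * t)))\<^sup>2) has_sum (1 / t * (\<integral>x. (cmod (h x))\<^sup>2 \<partial>lborel))) UNIV"
      by (simp add: int_f)
    then have "(\<integral>\<^sup>+n. ennreal ((cmod (fourier_integral h (s + of_int n * t)))\<^sup>2) \<partial>count_space (UNIV :: int set))
       = ennreal (1 / t * (\<integral>x. (cmod (h x))\<^sup>2 \<partial>lborel))"
      by (rule nn_integral_count_space_has_sum) simp
    also have "\<dots> = ennreal (1 / t) * sq_norm lborel h"
      using t sq_norm_integrable(2)[OF _ fin] by (subst ennreal_mult) auto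
    finally show ?thesis .
  qed
  have "sq_norm lborel (fourier_integral h) = (\<integral>\<^sup>+s. (ennreal (1 / t) * sq_norm lborel h) * indicator {0..<t} s \<partial>lborel)"
    unfolding sq_norm_def[of lborel "fourier_integral h"]
    by (subst nn_integral_periodization[OF t]) (auto simp: samples)
  also have "\<dots> = (ennreal (1 / t) * sq_norm lborel h) * ennreal t"
    using t by (simp add: nn_integral_cmult_indicator)
  also have "\<dots> = (ennreal (1 / t) * ennreal t) * sq_norm lborel h" by (simp add: mult_ac)
  also have "ennreal (1 / t) * ennreal t = 1"
    using t by (simp add: ennreal_mult[symmetric])
  finally show ?thesis by simp
qed

lemma cutoff_tendsto:
  assumes "f \<in> L2"
  shows "((\<lambda>R. sq_norm lborel (\<lambda>x. cutoff a R f x - f x)) \<longlongrightarrow> 0) at_top"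
proof (rule tendsto_at_topI_sequentially)
  fix X :: "nat \<Rightarrow> real" assume X: "filterlim X at_top sequentially"
  have [measurable]: "f \<in> borel_measurable borel" and fin: "sq_norm lborel f < \<infinity>"
    using assms by (auto simp: L2_iff)
  have [measurable]: "cutoff a R f \<in> borel_measurable borel" for R
    unfolding cutoff_def[abs_def] by measurable
  show "(\<lambda>n. sq_norm lborel (\<lambda>x. cutoff a (X n) f x - f x)) \<longlonglongrightarrow> 0"
  proof (rule sq_norm_dominated[where w = "\<lambda>x. (cmod (f x))\<^sup>2"])
    show "AE x in lborel. (\<lambda>n. cutoff a (X n) f x) \<longlonglongrightarrow> f x"
    proof (rule AE_I2)
      fix x
      have "\<forall>\<^sub>F n in sequentially. \<bar>x - a\<bar> \<le> X n"
        using X by (simp add: filterlim_at_top)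
      then have "\<forall>\<^sub>F n in sequentially. cutoff a (X n) f x = f x"
        by eventually_elim (auto simp: cutoff_def indicator_def)
      then show "(\<lambda>n. cutoff a (X n) f x) \<longlonglongrightarrow> f x" by (rule tendsto_eventually)
    qed
    show "AE x in lborel. (cmod (cutoff a (X n) f x - f x))\<^sup>2 \<le> (cmod (f x))\<^sup>2" for n
      by (auto simp: cutoff_def indicator_def)
    show "(\<integral>\<^sup>+x. ennreal ((cmod (f x))\<^sup>2) \<partial>lborel) < \<infinity>" using fin by (simp add: sq_norm_def)
  qed auto
qed

lemma ennreal_tendsto_0_le:
  fixes f g :: "'a \<Rightarrow> ennreal"
  assumes "\<And>a. f a \<le> g a" "(g \<longlongrightarrow> 0) F"
  shows "(f \<longlongrightarrow> 0) F"
  by (rule tendsto_sandwich[OF _ _ tendsto_const assms(2)]) (simp_all add: assms(1))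

lemma has_fourier_L2: "has_fourier f g \<Longrightarrow> f \<in> L2" "has_fourier f g \<Longrightarrow> g \<in> L2"
  by (simp_all add: has_fourier_def)

text \<open>Plancherel's identity for \<open>h\<close> minus a truncation of \<open>f\<close>, in the limit of large
  truncations. The case \<open>h = 0\<close> is the isometry property; in general it lets the transform of \<open>f\<close> be
  computed from any compactly supported approximations of \<open>f\<close>.\<close>
lemma has_fourier_distance_compact:
  assumes fg: "has_fourier f g" and h: "h \<in> L2_compact_support"
  shows "sq_norm lborel (\<lambda>\<xi>. fourier_integral h \<xi> - g \<xi>) = sq_norm lborel (\<lambda>x. h x - f x)"
proof -
  have f: "f \<in> L2" and g: "g \<in> L2" using fg by (auto dest: has_fourier_L2)
  have hL: "h \<in> L2" using h by (rule L2_compact_support_L2)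
  have [measurable]: "f \<in> borel_measurable borel" "g \<in> borel_measurable borel" "h \<in> borel_measurable borel"
    using f g hL by (auto simp: L2_iff)
  have cs: "cutoff 0 R f \<in> L2_compact_support" for R by (rule cutoff_compact_support[OF f])
  have [measurable]: "cutoff 0 R f \<in> borel_measurable borel" for R
    unfolding cutoff_def[abs_def] by measurable
  have u: "((\<lambda>R. sq_norm lborel (\<lambda>\<xi>. (fourier_integral h \<xi> - fourier_integral (cutoff 0 R f) \<xi>) - (fourier_integral h \<xi> - g \<xi>))) \<longlongrightarrow> 0) at_top"
    using fg by (simp add: has_fourier_def L2_tendsto_sq_norm fourier_truncated_fourier_integral sq_norm_minus_commute[of _ g])
  have v: "((\<lambda>R. sq_norm lborel (\<lambda>x. (h x - cutoff 0 R f x) - (h x - f x))) \<longlongrightarrow> 0) at_top"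
    using cutoff_tendsto[OF f, of 0] by (simp add: sq_norm_minus_commute[of _ f])
  have eq: "sq_norm lborel (\<lambda>\<xi>. fourier_integral h \<xi> - fourier_integral (cutoff 0 R f) \<xi>) = sq_norm lborel (\<lambda>x. h x - cutoff 0 R f x)" for R
    unfolding fourier_integral_diff[OF h cs, symmetric] by (rule plancherel_compact_support[OF L2_compact_support_diff[OF h cs]])
  show ?thesis
  proof (rule antisym)
    show "sq_norm lborel (\<lambda>\<xi>. fourier_integral h \<xi> - g \<xi>) \<le> sq_norm lborel (\<lambda>x. h x - f x)"
      by (rule sq_norm_limits_le[OF _ _ _ _ u v eq]) auto
    show "sq_norm lborel (\<lambda>x. h x - f x) \<le> sq_norm lborel (\<lambda>\<xi>. fourier_integral h \<xi> - g \<xi>)"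
      by (rule sq_norm_limits_le[OF _ _ _ _ v u eq[symmetric]]) auto
  qed
qed

theorem has_fourier_isometry:
  assumes "has_fourier f g"
  shows "sq_norm lborel g = sq_norm lborel f"
proof -
  have "(\<lambda>x. 0) \<in> L2_compact_support" by (simp add: L2_compact_support_def L2_zero)
  from has_fourier_distance_compact[OF assms this] show ?thesis by (simp add: fourier_integral_def sq_norm_def)
qed

lemma has_fourier_norm:
  assumes "has_fourier f g"
  shows "(LINT x|lborel. (cmod (f x))\<^sup>2) = (LINT x|lborel. (cmod (g x))\<^sup>2)"
proof -
  have "f \<in> L2" "g \<in> L2" using assms by (auto dest: has_fourier_L2)
  then have "sq_norm lborel f = ennreal (LINT x|lborel. (cmod (f x))\<^sup>2)" "sq_norm lborel g = ennreal (LINT x|lborel. (cmod (g x))\<^sup>2)"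
    by (auto simp: L2_iff intro: sq_norm_integrable)
  then show ?thesis using has_fourier_isometry[OF assms] by (simp add: ennreal_inj)
qed

lemma has_fourier_iff:
  "has_fourier f g \<longleftrightarrow> f \<in> L2 \<and> g \<in> L2 \<and> ((\<lambda>R. sq_norm lborel (\<lambda>\<xi>. fourier_integral (cutoff 0 R f) \<xi> - g \<xi>)) \<longlongrightarrow> 0) at_top"
  by (simp add: has_fourier_def L2_tendsto_sq_norm fourier_truncated_fourier_integral)

lemma has_fourier_add_cmult:
  assumes "has_fourier f g" "has_fourier f' g'"
  shows "has_fourier (\<lambda>x. f x + c * f' x) (\<lambda>\<xi>. g \<xi> + c * g' \<xi>)"
proof -
  have L: "f \<in> L2" "g \<in> L2" "f' \<in> L2" "g' \<in> L2" using assms by (auto dest: has_fourier_L2)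
  then have [measurable]: "f \<in> borel_measurable borel" "g \<in> borel_measurable borel"
    "f' \<in> borel_measurable borel" "g' \<in> borel_measurable borel"
    by (auto simp: L2_iff)
  have [measurable]: "cutoff 0 R f \<in> borel_measurable borel" "cutoff 0 R f' \<in> borel_measurable borel" for R
    unfolding cutoff_def[abs_def] by measurable
  let ?D = "\<lambda>R. sq_norm lborel (\<lambda>\<xi>. fourier_integral (cutoff 0 R f) \<xi> - g \<xi>)" 
  let ?D' = "\<lambda>R. sq_norm lborel (\<lambda>\<xi>. fourier_integral (cutoff 0 R f') \<xi> - g' \<xi>)"
  have "sq_norm lborel (\<lambda>\<xi>. fourier_integral (cutoff 0 R (\<lambda>x. f x + c * f' x)) \<xi> - (g \<xi> + c * g' \<xi>))
     \<le> 2 * ?D R + 2 * (ennreal ((cmod c)\<^sup>2) * ?D' R)" for R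
  proof -
    have "cutoff 0 R (\<lambda>x. f x + c * f' x) = (\<lambda>x. cutoff 0 R f x + c * cutoff 0 R f' x)"
      by (simp add: cutoff_def fun_eq_iff algebra_simps)
    then have "sq_norm lborel (\<lambda>\<xi>. fourier_integral (cutoff 0 R (\<lambda>x. f x + c * f' x)) \<xi> - (g \<xi> + c * g' \<xi>))
      = sq_norm lborel (\<lambda>\<xi>. (fourier_integral (cutoff 0 R f) \<xi> - g \<xi>) + c * (fourier_integral (cutoff 0 R f') \<xi> - g' \<xi>))"
      by (simp add: fourier_integral_add_cmult cutoff_compact_support L algebra_simps)
    also have "\<dots> \<le> 2 * ?D R + 2 * sq_norm lborel (\<lambda>\<xi>. c * (fourier_integral (cutoff 0 R f') \<xi> - g' \<xi>))"
      by (rule sq_norm_add_le) measurable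
    finally show ?thesis by (subst (asm) sq_norm_cmult) auto
  qed
  moreover have "((\<lambda>R. 2 * ?D R + 2 * (ennreal ((cmod c)\<^sup>2) * ?D' R)) \<longlongrightarrow> 2 * 0 + 2 * (ennreal ((cmod c)\<^sup>2) * 0)) at_top"
    using assms by (intro tendsto_add ennreal_tendsto_cmult) (simp_all add: has_fourier_iff)
  then have "((\<lambda>R. 2 * ?D R + 2 * (ennreal ((cmod c)\<^sup>2) * ?D' R)) \<longlongrightarrow> 0) at_top" by simp
  ultimately have "((\<lambda>R. sq_norm lborel (\<lambda>\<xi>. fourier_integral (cutoff 0 R (\<lambda>x. f x + c * f' x)) \<xi> - (g \<xi> + c * g' \<xi>))) \<longlongrightarrow> 0) at_top"
    by (rule ennreal_tendsto_0_le)
  then show ?thesis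
    using L by (auto simp: has_fourier_iff intro: L2_add L2_cmult)
qed

lemma has_fourier_zero: "has_fourier (\<lambda>x. 0) (\<lambda>x. 0)"
proof -
  have "cutoff 0 R (\<lambda>x. 0) = (\<lambda>x. 0)" for R by (simp add: cutoff_def fun_eq_iff)
  then show ?thesis by (simp add: has_fourier_iff L2_zero fourier_integral_def sq_norm_def)
qed

lemma has_fourier_sum:
  assumes "\<And>i. i \<in> I \<Longrightarrow> has_fourier (f i) (g i)"
  shows "has_fourier (\<lambda>x. \<Sum>i\<in>I. c i * f i x) (\<lambda>\<xi>. \<Sum>i\<in>I. c i * g i \<xi>)"
  using assms
proof (induction I rule: infinite_finite_induct)
  case (insert i I)
  then show ?case
    using has_fourier_add_cmult[of "\<lambda>x. \<Sum>i\<in>I. c i * f i x" "\<lambda>\<xi>. \<Sum>i\<in>I. c i * g i \<xi>" "f i" "g i" "c i"]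
    by (simp add: add.commute)
qed (auto simp: has_fourier_zero)

lemma has_fourier_shift:
  assumes "has_fourier f g"
  shows "has_fourier (shift a f) (\<lambda>\<xi>. cis (a * \<xi>) * g \<xi>)"
proof -
  have L: "f \<in> L2" "g \<in> L2" using assms by (auto dest: has_fourier_L2)
  have fourier_integral_shift: "fourier_integral (cutoff 0 R (shift a f)) \<xi> = cis (a * \<xi>) * fourier_integral (cutoff a R f) \<xi>" for R \<xi>
  proof -
    have "(LINT t|lborel. cutoff a R f t * exp (- (\<i> * complex_of_real (t * \<xi>))))
       = (LINT t|lborel. cutoff a R f (a + t) * exp (- (\<i> * complex_of_real ((a + t) * \<xi>))))"
      by (subst lborel_integral_real_affine[where c = 1 and t = a]) auto
    also have "\<dots> = (LINT t|lborel. cis (- (a * \<xi>)) * (cutoff 0 R (shift a f) t * exp (- (\<i> * complex_of_real (t * \<xi>)))))"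
      by (intro Bochner_Integration.integral_cong refl)
         (auto simp: cutoff_def shift_def indicator_def cis_conv_exp distrib_right exp_add[symmetric] algebra_simps)
    also have "\<dots> = cis (- (a * \<xi>)) * (LINT t|lborel. cutoff 0 R (shift a f) t * exp (- (\<i> * complex_of_real (t * \<xi>))))"
      by simp
    finally show ?thesis
      by (simp add: fourier_integral_def cis_mult mult.left_commute[of _ "cis _"] mult.assoc[symmetric])
  qed
  have "((\<lambda>R. sq_norm lborel (\<lambda>\<xi>. fourier_integral (cutoff a R f) \<xi> - g \<xi>)) \<longlongrightarrow> 0) at_top"
    using cutoff_tendsto[OF L(1)] by (simp add: has_fourier_distance_compact[OF assms cutoff_compact_support[OF L(1)]])
  moreover have "sq_norm lborel (\<lambda>\<xi>. fourier_integral (cutoff 0 R (shift a f)) \<xi> - cis (a * \<xi>) * g \<xi>)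
      = sq_norm lborel (\<lambda>\<xi>. fourier_integral (cutoff a R f) \<xi> - g \<xi>)" for R
    by (simp add: sq_norm_def fourier_integral_shift right_diff_distrib[symmetric] norm_mult)
  moreover have "(\<lambda>\<xi>. cis (a * \<xi>) * g \<xi>) \<in> L2"
    using L by (intro L2_bounded_mult[where B = 1] borel_measurable_continuous_onI continuous_intros) auto
  ultimately show ?thesis
    using L2_shift[OF L(1)] by (simp add: has_fourier_iff)
qed

text \<open>The truncated transforms of \<open>F\<close> are compared with \<open>g n\<close> by means of
  \<open>has_fourier_distance_compact\<close>, and \<open>n\<close> is sent to infinity before \<open>R\<close>. This produces
  functions with prescribed spectrum without an inversion formula.\<close>
lemma has_fourier_closed:
  assumes fg: "\<And>n::nat. has_fourier (f n) (g n)" and F: "F \<in> L2" and G: "G \<in> L2"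
    and fF: "(\<lambda>n. sq_norm lborel (\<lambda>x. f n x - F x)) \<longlonglongrightarrow> 0" and gG: "(\<lambda>n. sq_norm lborel (\<lambda>x. g n x - G x)) \<longlonglongrightarrow> 0"
  shows "has_fourier F G"
proof -
  have [measurable]: "F \<in> borel_measurable borel" "G \<in> borel_measurable borel"
    "f n \<in> borel_measurable borel" "g n \<in> borel_measurable borel" for n
    using fg[of n] F G by (auto simp: L2_iff has_fourier_def)
  have [measurable]: "cutoff 0 R F \<in> borel_measurable borel" for R
    unfolding cutoff_def[abs_def] by measurable
  have "sq_norm lborel (\<lambda>\<xi>. fourier_integral (cutoff 0 R F) \<xi> - G \<xi>) \<le> 4 * sq_norm lborel (\<lambda>x. cutoff 0 R F x - F x)" for R
  proof (rule tendsto_lowerbound)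
    show "\<forall>\<^sub>F n in sequentially. sq_norm lborel (\<lambda>\<xi>. fourier_integral (cutoff 0 R F) \<xi> - G \<xi>)
       \<le> 2 * (2 * sq_norm lborel (\<lambda>x. cutoff 0 R F x - F x) + 2 * sq_norm lborel (\<lambda>x. f n x - F x))
         + 2 * sq_norm lborel (\<lambda>x. g n x - G x)"
    proof (rule always_eventually, rule allI)
      fix n
      have "sq_norm lborel (\<lambda>\<xi>. fourier_integral (cutoff 0 R F) \<xi> - G \<xi>) \<le>
          2 * sq_norm lborel (\<lambda>\<xi>. fourier_integral (cutoff 0 R F) \<xi> - g n \<xi>) + 2 * sq_norm lborel (\<lambda>x. g n x - G x)"
        by (rule sq_norm_diff_le) measurable
      also have "sq_norm lborel (\<lambda>\<xi>. fourier_integral (cutoff 0 R F) \<xi> - g n \<xi>) = sq_norm lborel (\<lambda>x. cutoff 0 R F x - f n x)"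
        by (rule has_fourier_distance_compact[OF fg cutoff_compact_support[OF F]])
      also have "\<dots> \<le> 2 * sq_norm lborel (\<lambda>x. cutoff 0 R F x - F x) + 2 * sq_norm lborel (\<lambda>x. F x - f n x)"
        by (rule sq_norm_diff_le) measurable
      also have "sq_norm lborel (\<lambda>x. F x - f n x) = sq_norm lborel (\<lambda>x. f n x - F x)" by (rule sq_norm_minus_commute)
      finally show "sq_norm lborel (\<lambda>\<xi>. fourier_integral (cutoff 0 R F) \<xi> - G \<xi>)
       \<le> 2 * (2 * sq_norm lborel (\<lambda>x. cutoff 0 R F x - F x) + 2 * sq_norm lborel (\<lambda>x. f n x - F x))
         + 2 * sq_norm lborel (\<lambda>x. g n x - G x)"
        by (simp add: add_mono mult_left_mono)
    qed
    have "(\<lambda>n. 2 * (2 * sq_norm lborel (\<lambda>x. cutoff 0 R F x - F x) + 2 * sq_norm lborel (\<lambda>x. f n x - F x))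
         + 2 * sq_norm lborel (\<lambda>x. g n x - G x)) \<longlonglongrightarrow>
       2 * (2 * sq_norm lborel (\<lambda>x. cutoff 0 R F x - F x) + 2 * 0) + 2 * 0"
      by (intro tendsto_intros ennreal_tendsto_cmult fF gG) auto
    then show "(\<lambda>n. 2 * (2 * sq_norm lborel (\<lambda>x. cutoff 0 R F x - F x) + 2 * sq_norm lborel (\<lambda>x. f n x - F x))
         + 2 * sq_norm lborel (\<lambda>x. g n x - G x)) \<longlonglongrightarrow> 4 * sq_norm lborel (\<lambda>x. cutoff 0 R F x - F x)"
      by (simp add: mult.assoc[symmetric])
  qed simp
  moreover have "((\<lambda>R. 4 * sq_norm lborel (\<lambda>x. cutoff 0 R F x - F x)) \<longlongrightarrow> 4 * 0) at_top"
    by (intro ennreal_tendsto_cmult cutoff_tendsto F) auto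
  then have "((\<lambda>R. 4 * sq_norm lborel (\<lambda>x. cutoff 0 R F x - F x)) \<longlongrightarrow> 0) at_top" by simp
  ultimately have "((\<lambda>R. sq_norm lborel (\<lambda>\<xi>. fourier_integral (cutoff 0 R F) \<xi> - G \<xi>)) \<longlongrightarrow> 0) at_top"
    by (rule ennreal_tendsto_0_le)
  then show ?thesis using F G by (simp add: has_fourier_iff)
qed

text \<open>Polarization expresses inner products by norms, so the isometry property carries over to
  them.\<close>
lemma L2_inner_polarization:
  assumes "f \<in> L2" "g \<in> L2"
  shows "4 * L2_inner f g = 
      complex_of_real (LINT x|lborel. (cmod (f x + 1 * g x))\<^sup>2) - complex_of_real (LINT x|lborel. (cmod (f x + (-1) * g x))\<^sup>2)
      + \<i> * complex_of_real (LINT x|lborel. (cmod (f x + \<i> * g x))\<^sup>2) - \<i> * complex_of_real (LINT x|lborel. (cmod (f x + (-\<i>) * g x))\<^sup>2)"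
proof -
  have int: "integrable lborel (\<lambda>x. complex_of_real ((cmod (f x + c * g x))\<^sup>2))" for c
    using L2_add[OF assms(1) L2_cmult[OF assms(2), of c]] by (intro integrable_of_real) (simp add: L2_def)
  have "4 * L2_inner f g = (LINT x|lborel. 4 * (f x * cnj (g x)))"
    by (simp add: L2_inner_def)
  also have "\<dots> = (LINT x|lborel. complex_of_real ((cmod (f x + 1 * g x))\<^sup>2) - complex_of_real ((cmod (f x + (-1) * g x))\<^sup>2)
      + \<i> * complex_of_real ((cmod (f x + \<i> * g x))\<^sup>2) - \<i> * complex_of_real ((cmod (f x + (-\<i>) * g x))\<^sup>2))"
    unfolding complex_norm_square
    by (intro Bochner_Integration.integral_cong refl) (simp add: algebra_simps)
  also have "\<dots> = (LINT x|lborel. complex_of_real ((cmod (f x + 1 * g x))\<^sup>2)) - (LINT x|lborel. complex_of_real ((cmod (f x + (-1) * g x))\<^sup>2))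
      + \<i> * (LINT x|lborel. complex_of_real ((cmod (f x + \<i> * g x))\<^sup>2)) - \<i> * (LINT x|lborel. complex_of_real ((cmod (f x + (-\<i>) * g x))\<^sup>2))"
    using int[of 1] int[of "-1"] int[of "\<i>"] int[of "-\<i>"]
    by (simp only: Bochner_Integration.integral_add Bochner_Integration.integral_diff integral_mult_right_zero
        Bochner_Integration.integrable_add Bochner_Integration.integrable_diff integrable_mult_right)
  finally show ?thesis by (simp only: integral_complex_of_real)
qed

theorem has_fourier_inner:
  assumes "has_fourier f g" "has_fourier f' g'"
  shows "L2_inner f f' = L2_inner g g'"
proof -
  have L: "f \<in> L2" "g \<in> L2" "f' \<in> L2" "g' \<in> L2" using assms by (auto dest: has_fourier_L2)
  have "4 * L2_inner f f' = 4 * L2_inner g g'"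
    unfolding L2_inner_polarization[OF L(1,3)] L2_inner_polarization[OF L(2,4)]
    by (simp only: has_fourier_norm[OF has_fourier_add_cmult[OF assms]])
  then show ?thesis by simp
qed

section \<open>Uniform bounds for Vandermonde matrices\<close>
lemma matrix_bound:
  fixes A :: "nat \<Rightarrow> nat \<Rightarrow> complex"
  assumes "\<And>j k. j < L \<Longrightarrow> k < L \<Longrightarrow> cmod (A j k) \<le> C"
  shows "(\<Sum>j<L. (cmod (\<Sum>k<L. A j k * v k))\<^sup>2) \<le> C\<^sup>2 * (real L)\<^sup>2 * (\<Sum>k<L. (cmod (v k))\<^sup>2)"
proof -
  have "(cmod (\<Sum>k<L. A j k * v k))\<^sup>2 \<le> C\<^sup>2 * real L * (\<Sum>k<L. (cmod (v k))\<^sup>2)" if "j < L" for j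
  proof -
    have "cmod (\<Sum>k<L. A j k * v k) \<le> (\<Sum>k<L. C * cmod (v k))"
      using assms that by (intro sum_norm_le) (simp add: norm_mult mult_right_mono)
    then have "(cmod (\<Sum>k<L. A j k * v k))\<^sup>2 \<le> (\<Sum>k<L. C * cmod (v k))\<^sup>2"
      by (intro power_mono) auto
    also have "\<dots> = C\<^sup>2 * (\<Sum>k<L. cmod (v k))\<^sup>2"
      by (simp add: sum_distrib_left[symmetric] power_mult_distrib)
    also have "\<dots> \<le> C\<^sup>2 * ((\<Sum>k<L. (cmod (v k))\<^sup>2) * card {..<L})"
      by (intro mult_left_mono sum_squared_le_sum_of_squares) auto
    finally show ?thesis by (simp add: mult_ac)
  qed
  then have "(\<Sum>j<L. (cmod (\<Sum>k<L. A j k * v k))\<^sup>2) \<le> (\<Sum>j<L. C\<^sup>2 * real L * (\<Sum>k<L. (cmod (v k))\<^sup>2))"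
    by (intro sum_mono) auto
  then show ?thesis by (simp add: power2_eq_square mult_ac)
qed

text \<open>The values of the derivative symbol \<open>i\<xi>\<close> at the points \<open>x + kp\<close> that differ from
  \<open>x\<close> by a whole number of periods. Differences of nodes do not depend on \<open>x\<close>
  (see \<open>node_diff\<close>), so the denominators of the Lagrange polynomials are constants.\<close>
definition node :: "real \<Rightarrow> real \<Rightarrow> nat \<Rightarrow> complex" where
  "node p x k = \<i> * complex_of_real (x + real k * p)"

definition lagrange :: "nat \<Rightarrow> real \<Rightarrow> real \<Rightarrow> nat \<Rightarrow> complex poly" where
  "lagrange L p x k = smult (inverse (\<Prod>m\<in>{..<L} - {k}. node p x k - node p x m))
     (\<Prod>m\<in>{..<L} - {k}. [:- node p x m, 1:])"

lemma node_diff: "node p x k - node p x m = \<i> * complex_of_real ((real k - real m) * p)"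
  by (simp add: node_def algebra_simps)

lemma poly_lagrange:
  assumes "p \<noteq> 0" "k < L" "m < L"
  shows "poly (lagrange L p x k) (node p x m) = (if m = k then 1 else 0)"
proof (cases "m = k")
  case True
  have "(\<Prod>m\<in>{..<L} - {k}. node p x k - node p x m) \<noteq> 0"
    using assms by (auto simp: node_diff)
  then show ?thesis
    using True by (simp add: lagrange_def poly_prod)
next
  case False
  then have "(\<Prod>i\<in>{..<L} - {k}. node p x m - node p x i) = 0"
    using assms by (intro prod_zero) auto
  then show ?thesis
    using False by (simp add: lagrange_def poly_prod)
qed

lemma degree_lagrange:
  assumes "k < L" shows "degree (lagrange L p x k) < L"
proof -
  have "degree (lagrange L p x k) \<le> degree (\<Prod>m\<in>{..<L} - {k}. [:- node p x m, 1:])"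
    unfolding lagrange_def by (rule degree_smult_le)
  also have "\<dots> \<le> sum (degree \<circ> (\<lambda>m. [:- node p x m, 1:])) ({..<L} - {k})"
    by (rule degree_prod_sum_le) auto
  also have "\<dots> = card ({..<L} - {k})" by (simp add: o_def)
  also have "\<dots> < L" using assms by simp
  finally show ?thesis .
qed

lemma poly_eq_sum_coeff:
  fixes q :: "complex poly"
  assumes "degree q < L"
  shows "poly q z = (\<Sum>j<L. poly.coeff q j * z ^ j)"
proof -
  have "poly q z = (\<Sum>j\<le>degree q. poly.coeff q j * z ^ j)" by (rule poly_altdef)
  also have "\<dots> = (\<Sum>j<L. poly.coeff q j * z ^ j)"
    using assms by (intro sum.mono_neutral_left) (auto simp: coeff_eq_0)
  finally show ?thesis .
qed

text \<open>The coefficients of the Lagrange polynomials form the inverse Vandermonde matrix. This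
  lemma and the next one are the two orders of multiplication.\<close>
lemma inverse_vandermonde_left:
  assumes "p \<noteq> 0" "k < L" "m < L"
  shows "(\<Sum>j<L. poly.coeff (lagrange L p x k) j * node p x m ^ j) = (if m = k then 1 else 0)"
  using poly_lagrange[OF assms] poly_eq_sum_coeff[OF degree_lagrange[OF assms(2)]] by simp

lemma lagrange_interpolation:
  assumes p: "p \<noteq> 0" and j: "j < L"
  shows "E j = (\<Sum>k<L. poly.coeff (lagrange L p x k) j * (\<Sum>i<L. node p x k ^ i * E i))"
proof -
  define Q where "Q = (\<Sum>i<L. monom (E i) i)"
  have Q: "poly Q z = (\<Sum>i<L. z ^ i * E i)" for z
    by (simp add: Q_def poly_sum poly_monom mult.commute)
  have inj: "inj_on (node p x) {..<L}"
    using p by (auto simp: inj_on_def node_def)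
  have "Q = (\<Sum>k<L. smult (poly Q (node p x k)) (lagrange L p x k))"
  proof (rule poly_eqI_degree[where A = "node p x ` {..<L}"])
    show "poly Q z = poly (\<Sum>k<L. smult (poly Q (node p x k)) (lagrange L p x k)) z"
      if z: "z \<in> node p x ` {..<L}" for z
    proof -
      obtain m where m: "m < L" "z = node p x m" using z by auto
      have "poly (\<Sum>k<L. smult (poly Q (node p x k)) (lagrange L p x k)) z
        = (\<Sum>k<L. if m = k then poly Q (node p x k) else 0)"
        unfolding poly_sum using m p by (intro sum.cong) (auto simp: poly_lagrange)
      then show ?thesis using m by simp
    qed
    show "degree Q < card (node p x ` {..<L})"
      unfolding card_image[OF inj] Q_def using j
      by (simp, intro degree_sum_less) (auto intro: le_less_trans[OF degree_monom_le])
    show "degree (\<Sum>k<L. smult (poly Q (node p x k)) (lagrange L p x k)) < card (node p x ` {..<L})"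
      unfolding card_image[OF inj] using j
      by (simp, intro degree_sum_less) (auto intro: le_less_trans[OF degree_smult_le] degree_lagrange)
  qed
  then have "poly.coeff Q j = (\<Sum>k<L. poly Q (node p x k) * poly.coeff (lagrange L p x k) j)"
    by (subst (asm) poly_eq_iff) (simp add: coeff_sum)
  moreover have "poly.coeff Q j = E j"
    using j by (simp add: Q_def coeff_sum)
  ultimately show ?thesis by (simp add: Q mult.commute)
qed

lemma continuous_on_coeff_prod_linear:
  fixes f :: "'i \<Rightarrow> 'a::topological_space \<Rightarrow> complex"
  assumes "\<And>m. m \<in> I \<Longrightarrow> continuous_on S (f m)"
  shows "continuous_on S (\<lambda>x. poly.coeff (\<Prod>m\<in>I. [:f m x, 1:]) j)"
  using assms
proof (induction I arbitrary: j rule: infinite_finite_induct)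
  case (insert m I)
  have "poly.coeff (\<Prod>m\<in>insert m I. [:f m x, 1:]) j =
     f m x * poly.coeff (\<Prod>m\<in>I. [:f m x, 1:]) j
     + (case j of 0 \<Rightarrow> 0 | Suc i \<Rightarrow> poly.coeff (\<Prod>m\<in>I. [:f m x, 1:]) i)" for x
    using insert.hyps by (simp add: coeff_pCons split: nat.split)
  then show ?case
    using insert by (cases j) (auto intro!: continuous_intros)
qed auto

text \<open>The entries of the matrix and of its inverse are continuous in \<open>x\<close>, and \<open>x\<close> ranges over a
  compact interval.\<close>
lemma vandermonde_entries_bounded:
  assumes "p \<noteq> 0"
  obtains C where "C \<ge> 1" 
    "\<And>x j k. x \<in> {a..b} \<Longrightarrow> j < L \<Longrightarrow> k < L \<Longrightarrow> cmod (node p x k ^ j) \<le> C"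
    "\<And>x j k. x \<in> {a..b} \<Longrightarrow> j < L \<Longrightarrow> k < L \<Longrightarrow> cmod (poly.coeff (lagrange L p x k) j) \<le> C"
proof -
  have bdd: "\<exists>C. \<forall>x\<in>{a..b}. cmod (f x) \<le> C" if "continuous_on {a..b} f" for f :: "real \<Rightarrow> complex"
    using compact_imp_bounded[OF compact_continuous_image[OF that compact_Icc]]
    by (auto simp: bounded_iff)
  have "\<exists>C. \<forall>x\<in>{a..b}. cmod (node p x k ^ j) \<le> C" for j k
    unfolding node_def by (intro bdd continuous_intros)
  then have "\<forall>j k. \<exists>C. \<forall>x\<in>{a..b}. cmod (node p x k ^ j) \<le> C" by blast
  then obtain C1 where C1: "\<And>j k x. x \<in> {a..b} \<Longrightarrow> cmod (node p x k ^ j) \<le> C1 j k" by metis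
  have "\<exists>C. \<forall>x\<in>{a..b}. cmod (poly.coeff (lagrange L p x k) j) \<le> C" for j k
  proof (rule bdd)
    have "continuous_on {a..b} (\<lambda>x. poly.coeff (\<Prod>m\<in>{..<L} - {k}. [:- node p x m, 1:]) j)"
      unfolding node_def by (intro continuous_on_coeff_prod_linear continuous_intros)
    then show "continuous_on {a..b} (\<lambda>x. poly.coeff (lagrange L p x k) j)"
      unfolding lagrange_def node_diff coeff_smult by (intro continuous_intros)
  qed
  then have "\<forall>j k. \<exists>C. \<forall>x\<in>{a..b}. cmod (poly.coeff (lagrange L p x k) j) \<le> C" by blast
  then obtain C2 where C2: "\<And>j k x. x \<in> {a..b} \<Longrightarrow> cmod (poly.coeff (lagrange L p x k) j) \<le> C2 j k" by metis
  define C where "C = 1 + (\<Sum>j<L. \<Sum>k<L. \<bar>C1 j k\<bar> + \<bar>C2 j k\<bar>)"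
  have C: "\<bar>C1 j k\<bar> + \<bar>C2 j k\<bar> \<le> C" if "j < L" "k < L" for j k
  proof -
    have "\<bar>C1 j k\<bar> + \<bar>C2 j k\<bar> \<le> (\<Sum>k<L. \<bar>C1 j k\<bar> + \<bar>C2 j k\<bar>)"
      using that by (intro member_le_sum[of k "{..<L}" "\<lambda>k. \<bar>C1 j k\<bar> + \<bar>C2 j k\<bar>"]) auto
    also have "\<dots> \<le> (\<Sum>j<L. \<Sum>k<L. \<bar>C1 j k\<bar> + \<bar>C2 j k\<bar>)"
      using that by (intro member_le_sum[of j "{..<L}" "\<lambda>j. \<Sum>k<L. \<bar>C1 j k\<bar> + \<bar>C2 j k\<bar>"]) (auto intro: sum_nonneg)
    finally show ?thesis by (simp add: C_def)
  qed
  show ?thesis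
  proof
    show "C \<ge> 1" unfolding C_def by (auto intro!: sum_nonneg)
    show "cmod (node p x k ^ j) \<le> C" if "x \<in> {a..b}" "j < L" "k < L" for x j k
      using C1[OF that(1), where j = j and k = k] C[OF that(2,3)] by linarith
    show "cmod (poly.coeff (lagrange L p x k) j) \<le> C" if "x \<in> {a..b}" "j < L" "k < L" for x j k
      using C2[OF that(1), where j = j and k = k] C[OF that(2,3)] by linarith
  qed
qed

text \<open>The first two estimates, for the conjugate matrix acting on vectors indexed by the periods,
  serve the frame inequalities; the last two, for the transposed matrix acting on vectors indexed by
  the generators, serve the Riesz basis.\<close>
lemma vandermonde_bounds:
  assumes p: "p \<noteq> 0"
  obtains K where "K \<ge> 0"
    "\<And>x v. x \<in> {a..b} \<Longrightarrow> (\<Sum>j<L. (cmod (\<Sum>k<L. cnj (node p x k ^ j) * v k))\<^sup>2) \<le> K * (\<Sum>k<L. (cmod (v k))\<^sup>2)"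
    "\<And>x v. x \<in> {a..b} \<Longrightarrow> (\<Sum>k<L. (cmod (v k))\<^sup>2) \<le> K * (\<Sum>j<L. (cmod (\<Sum>k<L. cnj (node p x k ^ j) * v k))\<^sup>2)"
    "\<And>x E. x \<in> {a..b} \<Longrightarrow> (\<Sum>k<L. (cmod (\<Sum>j<L. node p x k ^ j * E j))\<^sup>2) \<le> K * (\<Sum>j<L. (cmod (E j))\<^sup>2)"
    "\<And>x E. x \<in> {a..b} \<Longrightarrow> (\<Sum>j<L. (cmod (E j))\<^sup>2) \<le> K * (\<Sum>k<L. (cmod (\<Sum>j<L. node p x k ^ j * E j))\<^sup>2)"
proof -
  obtain C where C: "C \<ge> 1" 
    "\<And>x j k. x \<in> {a..b} \<Longrightarrow> j < L \<Longrightarrow> k < L \<Longrightarrow> cmod (node p x k ^ j) \<le> C"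
    "\<And>x j k. x \<in> {a..b} \<Longrightarrow> j < L \<Longrightarrow> k < L \<Longrightarrow> cmod (poly.coeff (lagrange L p x k) j) \<le> C"
    using vandermonde_entries_bounded[OF p] by metis
  let ?K = "C\<^sup>2 * (real L)\<^sup>2"
  show ?thesis
  proof (rule that[of ?K])
    show "?K \<ge> 0" by simp
    show "(\<Sum>j<L. (cmod (\<Sum>k<L. cnj (node p x k ^ j) * v k))\<^sup>2) \<le> ?K * (\<Sum>k<L. (cmod (v k))\<^sup>2)"
      if "x \<in> {a..b}" for x v
      using C(2)[OF that] by (intro matrix_bound) (simp del: complex_cnj_power)
    show "(\<Sum>k<L. (cmod (\<Sum>j<L. node p x k ^ j * E j))\<^sup>2) \<le> ?K * (\<Sum>j<L. (cmod (E j))\<^sup>2)"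
      if "x \<in> {a..b}" for x E
      using C(2)[OF that] by (intro matrix_bound)
    show "(\<Sum>j<L. (cmod (E j))\<^sup>2) \<le> ?K * (\<Sum>k<L. (cmod (\<Sum>j<L. node p x k ^ j * E j))\<^sup>2)"
      if "x \<in> {a..b}" for x E
    proof -
      have "(\<Sum>j<L. (cmod (E j))\<^sup>2)
        = (\<Sum>j<L. (cmod (\<Sum>k<L. poly.coeff (lagrange L p x k) j * (\<Sum>i<L. node p x k ^ i * E i)))\<^sup>2)"
        by (intro sum.cong refl) (subst lagrange_interpolation[OF p, of _ L E x], auto)
      also have "\<dots> \<le> ?K * (\<Sum>k<L. (cmod (\<Sum>j<L. node p x k ^ j * E j))\<^sup>2)"
        using C(3)[OF that] by (intro matrix_bound)
      finally show ?thesis .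
    qed
    show "(\<Sum>k<L. (cmod (v k))\<^sup>2) \<le> ?K * (\<Sum>j<L. (cmod (\<Sum>k<L. cnj (node p x k ^ j) * v k))\<^sup>2)"
      if "x \<in> {a..b}" for x v
    proof -
      have v: "v m = (\<Sum>j<L. cnj (poly.coeff (lagrange L p x m) j) * (\<Sum>k<L. cnj (node p x k ^ j) * v k))" if "m < L" for m
      proof -
        have "(\<Sum>j<L. cnj (poly.coeff (lagrange L p x m) j) * (\<Sum>k<L. cnj (node p x k ^ j) * v k))
           = (\<Sum>k<L. cnj (\<Sum>j<L. poly.coeff (lagrange L p x m) j * node p x k ^ j) * v k)"
          by (simp add: sum_distrib_left sum_distrib_right mult.assoc) (rule sum.swap)
        also have "\<dots> = (\<Sum>k<L. if m = k then v k else 0)"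
          using that by (intro sum.cong refl) (auto simp: inverse_vandermonde_left[OF p])
        finally show ?thesis using that by simp
      qed
      have "(\<Sum>m<L. (cmod (v m))\<^sup>2)
        = (\<Sum>m<L. (cmod (\<Sum>j<L. cnj (poly.coeff (lagrange L p x m) j) * (\<Sum>k<L. cnj (node p x k ^ j) * v k)))\<^sup>2)"
        by (intro sum.cong refl arg_cong[where f = "\<lambda>z. (cmod z)\<^sup>2"] v) auto
      also have "\<dots> \<le> ?K * (\<Sum>j<L. (cmod (\<Sum>k<L. cnj (node p x k ^ j) * v k))\<^sup>2)"
        using C(3)[OF that] by (intro matrix_bound) simp
      finally show ?thesis .
    qed
  qed
qed

section \<open>The frame inequalities\<close>

text \<open>The integrals of \<open>G\<close> over the \<open>L\<close> consecutive periods are moved to the first one.\<close>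
lemma integral_fold:
  fixes G :: "real \<Rightarrow> 'b::{banach, second_countable_topology}"
  assumes G: "integrable lborel G" and supp: "\<And>x. x \<notin> {a..<a + real L * p} \<Longrightarrow> G x = 0" and p: "p \<ge> 0"
  shows "integrable (restrict_space lborel {a..<a + p}) (\<lambda>x. \<Sum>k<L. G (x + real k * p))"
    and "(\<integral>x. (\<Sum>k<L. G (x + real k * p)) \<partial>restrict_space lborel {a..<a + p}) = (\<integral>x. G x \<partial>lborel)"
proof -
  define T where "T k x = indicator {a..<a + p} x *\<^sub>R G (x + real k * p)" for k :: nat and x
  define U where "U k x = indicator {a + real k * p..<a + real k * p + p} x *\<^sub>R G x" for k :: nat and x
  have U: "integrable lborel (U k)" for k
    unfolding U_def by (intro integrable_mult_indicator G) auto
  have TU: "T k = (\<lambda>x. U k (real k * p + 1 * x))" for k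
    by (auto simp: T_def U_def fun_eq_iff indicator_def add.commute)
  have T: "integrable lborel (T k)" for k
    unfolding TU by (intro lborel_integrable_real_affine U) simp
  have intT: "(\<integral>x. T k x \<partial>lborel) = (\<integral>x. U k x \<partial>lborel)" for k
    unfolding TU by (subst (2) lborel_integral_real_affine[where c = 1 and t = "real k * p"]) auto
  have sumT: "indicator {a..<a + p} x *\<^sub>R (\<Sum>k<L. G (x + real k * p)) = (\<Sum>k<L. T k x)" for x
    by (simp add: T_def scaleR_sum_right)
  show "integrable (restrict_space lborel {a..<a + p}) (\<lambda>x. \<Sum>k<L. G (x + real k * p))"
    by (subst integrable_restrict_space) (auto simp: sumT intro: T)
  have tile: "(\<Sum>k<n. indicator {a + real k * p..<a + real k * p + p} x) = (indicator {a..<a + real n * p} x :: real)" for n x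
  proof (induction n)
    case (Suc n)
    have "{a..<a + real n * p} \<union> {a + real n * p..<a + real n * p + p} = {a..<a + real n * p + p}"
      using p by (intro ivl_disj_un_two(3)) auto
    then have "{a..<a + real (Suc n) * p} = {a..<a + real n * p} \<union> {a + real n * p..<a + real n * p + p}"
      by (simp add: algebra_simps)
    moreover have "{a..<a + real n * p} \<inter> {a + real n * p..<a + real n * p + p} = {}" by auto
    ultimately show ?case
      using Suc by (simp add: indicator_add)
  qed simp
  have "(\<integral>x. (\<Sum>k<L. G (x + real k * p)) \<partial>restrict_space lborel {a..<a + p}) = (\<integral>x. (\<Sum>k<L. T k x) \<partial>lborel)"
    by (subst integral_restrict_space) (auto simp: sumT)
  also have "\<dots> = (\<Sum>k<L. (\<integral>x. U k x \<partial>lborel))"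
    using T by (simp add: Bochner_Integration.integral_sum intT)
  also have "\<dots> = (\<integral>x. (\<Sum>k<L. U k x) \<partial>lborel)"
    using U by (simp add: Bochner_Integration.integral_sum)
  also have "\<dots> = (\<integral>x. G x \<partial>lborel)"
  proof (intro Bochner_Integration.integral_cong refl)
    fix x
    have "(\<Sum>k<L. U k x) = (\<Sum>k<L. indicator {a + real k * p..<a + real k * p + p} x) *\<^sub>R G x"
      by (simp add: U_def scaleR_sum_left)
    then show "(\<Sum>k<L. U k x) = G x"
      using supp[of x] unfolding tile by (cases "x \<in> {a..<a + real L * p}") auto
  qed
  finally show "(\<integral>x. (\<Sum>k<L. G (x + real k * p)) \<partial>restrict_space lborel {a..<a + p}) = (\<integral>x. G x \<partial>lborel)" .
qed

lemma has_fourier_cong_AE: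
  assumes "has_fourier f g" and [measurable]: "g' \<in> borel_measurable borel" and ae: "AE x in lborel. g x = g' x"
  shows "has_fourier f g'"
proof -
  have "sq_norm lborel g = sq_norm lborel g'" using ae by (rule sq_norm_cong_AE)
  moreover have "sq_norm lborel (\<lambda>\<xi>. fourier_integral (cutoff 0 R f) \<xi> - g \<xi>) = sq_norm lborel (\<lambda>\<xi>. fourier_integral (cutoff 0 R f) \<xi> - g' \<xi>)" for R
    using ae by (intro sq_norm_cong_AE) auto
  ultimately show ?thesis using assms by (auto simp: has_fourier_iff L2_iff)
qed

text \<open>Removing the end point \<open>\<omega>\<close> changes the spectrum on a null set only, but makes the band
  half-open like the periods that cover it.\<close>
lemma band_limited_spectrum:
  assumes "f \<in> band_limited \<omega>"
  obtains g where "has_fourier f g" "\<And>x. x \<notin> {-\<omega>..<\<omega>} \<Longrightarrow> g x = 0"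
proof -
  obtain g where g: "has_fourier f g" "AE \<xi> in lborel. \<xi> \<notin> {-\<omega>..\<omega>} \<longrightarrow> g \<xi> = 0"
    using assms by (auto simp: band_limited_def)
  then have [measurable]: "g \<in> borel_measurable borel" by (auto simp: has_fourier_def L2_iff)
  have "AE x in lborel. g x = indicator {-\<omega>..<\<omega>} x * g x"
    using g(2) AE_lborel_singleton[of \<omega>] by eventually_elim (auto simp: indicator_def)
  then have "has_fourier f (\<lambda>x. indicator {-\<omega>..<\<omega>} x * g x)"
    by (intro has_fourier_cong_AE[OF g(1)]) auto
  then show ?thesis by (rule that) auto
qed

lemma sum_from_1_eq_lessThan: "(\<Sum>j=1..L. f j) = (\<Sum>j<L. f (Suc j))"
  using sum.atLeast1_atMost_eq[of f L] by simp

locale derivative_translates =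
  fixes \<omega> t :: real and L :: nat and \<phi> :: "nat \<Rightarrow> real \<Rightarrow> complex"
  assumes \<omega>: "\<omega> > 0" and t: "t > 0" and sampling: "t \<le> real L * (pi / \<omega>)"
    and \<phi>: "\<And>j. j \<in> {1..L} \<Longrightarrow>
      has_fourier (\<phi> j) (\<lambda>x. (\<i> * complex_of_real x) ^ (j - 1) * indicator {-\<omega>..\<omega>} x)"
begin

definition p where "p = 2 * pi / t"

abbreviation M where "M \<equiv> restrict_space lborel {-\<omega>..<-\<omega> + p}"

lemma p: "p > 0" "p \<ge> 0" "p \<noteq> 0"
  using t by (simp_all add: p_def)

lemma M_period: "M = period_measure t (-\<omega>)"
  by (simp add: p_def)

lemma band_covered: "\<omega> \<le> -\<omega> + real L * p"
  using sampling \<omega> t by (simp add: p_def field_simps)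

lemma mode_shift_p: "mode t n (x + real k * p) = mode t n x"
  using mode_period[OF t, of n x "int k"] by (simp add: p_def)

lemma has_fourier_translate:
  assumes "j < L"
  shows "has_fourier (shift (of_int n * t) (\<phi> (Suc j)))
    (\<lambda>\<xi>. mode t n \<xi> * ((\<i> * complex_of_real \<xi>) ^ j * indicator {-\<omega>..\<omega>} \<xi>))"
  using has_fourier_shift[OF \<phi>[of "Suc j"], of "of_int n * t"] assms by (simp add: mode_def)

lemma translate_band_limited:
  assumes "j \<in> {1..L}"
  shows "shift (of_int n * t) (\<phi> j) \<in> band_limited \<omega>"
proof -
  obtain i where i: "j = Suc i" "i < L" using assms by (cases j) auto
  show ?thesis
    using has_fourier_translate[OF i(2), of n] has_fourier_L2(1)[OF has_fourier_translate[OF i(2), of n]]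
    unfolding i(1) band_limited_def by (auto intro!: exI AE_I2 simp: indicator_def)
qed

text \<open>The folded function of a spectrum \<open>g\<close>. Here \<open>j\<close> starts at 0 and is the order of the
  derivative, so the generator is \<open>\<phi> (Suc j)\<close>.\<close>
definition analysis_symbol :: "(real \<Rightarrow> complex) \<Rightarrow> nat \<Rightarrow> real \<Rightarrow> complex" where
  "analysis_symbol g j x = (\<Sum>k<L. cnj (node p x k ^ j) * g (x + real k * p))"

lemma frame_coefficient:
  assumes fg: "has_fourier f g" and g0: "\<And>x. x \<notin> {-\<omega>..<\<omega>} \<Longrightarrow> g x = 0" and j: "j < L"
  shows "L2_inner f (shift (of_int n * t) (\<phi> (Suc j))) = (\<integral>x. analysis_symbol g j x * cnj (mode t n x) \<partial>M)"
proof -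
  have gL: "g \<in> L2" using fg by (rule has_fourier_L2)
  define h where "h x = cnj ((\<i> * complex_of_real x) ^ j) * g x" for x
  have "h \<in> L2" unfolding h_def[abs_def]
  proof (rule L2_bounded_mult[OF gL, where B = "\<omega> ^ j"])
    show "(\<lambda>x. cnj ((\<i> * complex_of_real x) ^ j)) \<in> borel_measurable borel"
      by (intro borel_measurable_continuous_onI continuous_intros)
    show "cmod (cnj ((\<i> * complex_of_real x) ^ j)) \<le> \<omega> ^ j" if "g x \<noteq> 0" for x
    proof -
      have "\<bar>x\<bar> \<le> \<omega>" using g0[of x] that by (cases "x \<in> {-\<omega>..<\<omega>}") auto
      then show ?thesis by (simp add: norm_power norm_mult power_mono)
    qed
  qed
  moreover have h0: "h x = 0" if "x \<notin> {-\<omega>..<\<omega>}" for x using g0[OF that] by (simp add: h_def)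
  ultimately have "h \<in> L2_compact_support"
    unfolding L2_compact_support_def by (auto intro!: exI[of _ \<omega>])
  then have int: "integrable lborel (\<lambda>x. h x * cnj (mode t n x))"
    by (rule L2_compact_support_integrable) (auto simp: cnj_mode)
  have "L2_inner f (shift (of_int n * t) (\<phi> (Suc j))) = 
     L2_inner g (\<lambda>\<xi>. mode t n \<xi> * ((\<i> * complex_of_real \<xi>) ^ j * indicator {-\<omega>..\<omega>} \<xi>))"
    by (rule has_fourier_inner[OF fg has_fourier_translate[OF j]])
  also have "\<dots> = (\<integral>x. h x * cnj (mode t n x) \<partial>lborel)"
    unfolding L2_inner_def
  proof (intro Bochner_Integration.integral_cong refl)
    fix x
    show "g x * cnj (mode t n x * ((\<i> * complex_of_real x) ^ j * indicator {- \<omega>..\<omega>} x)) = h x * cnj (mode t n x)"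
      using g0[of x] by (cases "x \<in> {-\<omega>..<\<omega>}") (auto simp: h_def)
  qed
  also have "\<dots> = (\<integral>x. (\<Sum>k<L. h (x + real k * p) * cnj (mode t n (x + real k * p))) \<partial>M)"
    using h0 band_covered by (intro integral_fold(2)[symmetric, OF int]) (auto simp: p)
  also have "\<dots> = (\<integral>x. analysis_symbol g j x * cnj (mode t n x) \<partial>M)"
    unfolding mode_shift_p
    by (intro Bochner_Integration.integral_cong refl) (simp add: analysis_symbol_def h_def node_def sum_distrib_right)
  finally show ?thesis .
qed

lemma spectrum_norm:
  assumes gL: "g \<in> L2" and g0: "\<And>x. x \<notin> {-\<omega>..<\<omega>} \<Longrightarrow> g x = 0"
  shows "integrable M (\<lambda>x. \<Sum>k<L. (cmod (g (x + real k * p)))\<^sup>2)"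
    and "(\<integral>x. (\<Sum>k<L. (cmod (g (x + real k * p)))\<^sup>2) \<partial>M) = (\<integral>x. (cmod (g x))\<^sup>2 \<partial>lborel)"
proof -
  have int: "integrable lborel (\<lambda>x. (cmod (g x))\<^sup>2)" using gL by (simp add: L2_def)
  have supp: "(cmod (g x))\<^sup>2 = 0" if "x \<notin> {-\<omega>..<-\<omega> + real L * p}" for x
    using g0[of x] that band_covered by auto
  show "integrable M (\<lambda>x. \<Sum>k<L. (cmod (g (x + real k * p)))\<^sup>2)"
    by (rule integral_fold(1)[OF int supp p(2)])
  show "(\<integral>x. (\<Sum>k<L. (cmod (g (x + real k * p)))\<^sup>2) \<partial>M) = (\<integral>x. (cmod (g x))\<^sup>2 \<partial>lborel)"
    by (rule integral_fold(2)[OF int supp p(2)])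
qed

lemma borel_measurable_analysis_symbol [measurable]:
  assumes [measurable]: "g \<in> borel_measurable borel"
  shows "analysis_symbol g j \<in> borel_measurable borel"
proof -
  have [measurable]: "(\<lambda>x. cnj (node p x k ^ j)) \<in> borel_measurable borel" for k
    unfolding node_def by (intro borel_measurable_continuous_onI continuous_intros)
  show ?thesis unfolding analysis_symbol_def[abs_def] by measurable
qed

theorem frame: "is_frame \<omega> L \<phi> t"
proof -
  obtain K where K0: "K \<ge> 0"
    and upper: "\<And>x v. x \<in> {-\<omega>..-\<omega> + p} \<Longrightarrow>
      (\<Sum>j<L. (cmod (\<Sum>k<L. cnj (node p x k ^ j) * v k))\<^sup>2) \<le> K * (\<Sum>k<L. (cmod (v k))\<^sup>2)"
    and lower: "\<And>x v. x \<in> {-\<omega>..-\<omega> + p} \<Longrightarrow>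
      (\<Sum>k<L. (cmod (v k))\<^sup>2) \<le> K * (\<Sum>j<L. (cmod (\<Sum>k<L. cnj (node p x k ^ j) * v k))\<^sup>2)"
    by (rule vandermonde_bounds[OF p(3), of "-\<omega>" "-\<omega> + p" L]) (rule that)
  \<comment> \<open>\<open>K + 1\<close> instead of \<open>K\<close> keeps the denominator positive and gives \<open>A \<le> p \<le> B\<close>.\<close>
  define A where "A = p / (K + 1)"
  define B where "B = p * (K + 1)"
  have "0 < A" using p K0 by (simp add: A_def)
  moreover have "A \<le> B"
  proof -
    have "A \<le> p" using p K0 by (simp add: A_def field_simps)
    also have "\<dots> \<le> B" using p K0 by (simp add: B_def field_simps)
    finally show ?thesis .
  qed
  moreover have "(\<forall>j\<in>{1..L}. (\<lambda>n::int. (cmod (L2_inner f (shift (of_int n * t) (\<phi> j))))\<^sup>2) summable_on UNIV) \<and>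
     A * (L2_norm f)\<^sup>2 \<le> (\<Sum>j=1..L. \<Sum>\<^sub>\<infinity>n::int. (cmod (L2_inner f (shift (of_int n * t) (\<phi> j))))\<^sup>2) \<and>
     (\<Sum>j=1..L. \<Sum>\<^sub>\<infinity>n::int. (cmod (L2_inner f (shift (of_int n * t) (\<phi> j))))\<^sup>2) \<le> B * (L2_norm f)\<^sup>2"
    if "f \<in> band_limited \<omega>" for f
  proof -
    obtain g where fg: "has_fourier f g" and g0: "\<And>x. x \<notin> {-\<omega>..<\<omega>} \<Longrightarrow> g x = 0"
      using band_limited_spectrum[OF \<open>f \<in> band_limited \<omega>\<close>] by metis
    have gL: "g \<in> L2" using fg by (rule has_fourier_L2)
    then have [measurable]: "g \<in> borel_measurable borel" by (simp add: L2_iff)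
    define N where "N x = (\<Sum>k<L. (cmod (g (x + real k * p)))\<^sup>2)" for x
    have intN: "integrable M N" "(\<integral>x. N x \<partial>M) = (\<integral>x. (cmod (g x))\<^sup>2 \<partial>lborel)"
      unfolding N_def using spectrum_norm[OF gL g0] by auto
    have norm: "(L2_norm f)\<^sup>2 = (\<integral>x. N x \<partial>M)"
      unfolding intN(2) has_fourier_norm[OF fg, symmetric] by (simp add: L2_norm_def)
    let ?F = "analysis_symbol g"
    have F_upper: "(\<Sum>j<L. (cmod (?F j x))\<^sup>2) \<le> K * N x"
      and F_lower: "N x \<le> K * (\<Sum>j<L. (cmod (?F j x))\<^sup>2)" if "x \<in> space M" for x
      using that upper[of x "\<lambda>k. g (x + real k * p)"] lower[of x "\<lambda>k. g (x + real k * p)"]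
      by (auto simp: analysis_symbol_def N_def space_restrict_space)
    have intF: "integrable M (\<lambda>x. (cmod (?F j x))\<^sup>2)" if "j < L" for j
    proof (rule Bochner_Integration.integrable_bound)
      show "integrable M (\<lambda>x. K * N x)" using intN by simp
      show "(\<lambda>x. (cmod (?F j x))\<^sup>2) \<in> borel_measurable M"
        by (rule measurable_restrict_space1) simp
      show "AE x in M. norm ((cmod (?F j x))\<^sup>2) \<le> norm (K * N x)"
      proof (rule AE_I2)
        fix x assume "x \<in> space M"
        have "(cmod (?F j x))\<^sup>2 \<le> (\<Sum>j<L. (cmod (?F j x))\<^sup>2)"
          using that by (intro member_le_sum[of j "{..<L}" "\<lambda>j. (cmod (?F j x))\<^sup>2"]) auto
        also have "\<dots> \<le> K * N x" by (rule F_upper) fact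
        finally show "norm ((cmod (?F j x))\<^sup>2) \<le> norm (K * N x)" by simp
      qed
    qed
    have hs: "((\<lambda>n::int. (cmod (L2_inner f (shift (of_int n * t) (\<phi> (Suc j)))))\<^sup>2) has_sum
        (p * (\<integral>x. (cmod (?F j x))\<^sup>2 \<partial>M))) UNIV" if "j < L" for j
      unfolding p_def
    proof (rule parseval[OF t])
      show "sq_norm (period_measure t (-\<omega>)) (?F j) < \<infinity>"
        using intF[OF that] unfolding M_period sq_norm_def by (simp add: nn_integral_eq_integral)
      show "L2_inner f (shift (of_int n * t) (\<phi> (Suc j))) =
          (\<integral>x. ?F j x * cnj (mode t n x) \<partial>period_measure t (-\<omega>))" for n
        by (rule frame_coefficient[OF fg g0 that, unfolded p_def])
    qed measurable
    have sum_eq: "(\<Sum>j=1..L. \<Sum>\<^sub>\<infinity>n::int. (cmod (L2_inner f (shift (of_int n * t) (\<phi> j))))\<^sup>2)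
        = p * (\<integral>x. (\<Sum>j<L. (cmod (?F j x))\<^sup>2) \<partial>M)"
      unfolding sum_from_1_eq_lessThan using intF
      by (simp add: infsumI[OF hs] Bochner_Integration.integral_sum sum_distrib_left)
    have intS: "integrable M (\<lambda>x. \<Sum>j<L. (cmod (?F j x))\<^sup>2)" using intF by auto
    have "(\<integral>x. (\<Sum>j<L. (cmod (?F j x))\<^sup>2) \<partial>M) \<le> (\<integral>x. K * N x \<partial>M)"
      using intS intN F_upper by (intro integral_mono) auto
    then have S_le: "(\<integral>x. (\<Sum>j<L. (cmod (?F j x))\<^sup>2) \<partial>M) \<le> K * (\<integral>x. N x \<partial>M)" by simp
    have "(\<integral>x. N x \<partial>M) \<le> (\<integral>x. K * (\<Sum>j<L. (cmod (?F j x))\<^sup>2) \<partial>M)"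
      using intS intN F_lower by (intro integral_mono) auto
    then have S_ge: "(\<integral>x. N x \<partial>M) \<le> K * (\<integral>x. (\<Sum>j<L. (cmod (?F j x))\<^sup>2) \<partial>M)" by simp
    have pos: "0 \<le> (\<integral>x. N x \<partial>M)" "0 \<le> (\<integral>x. (\<Sum>j<L. (cmod (?F j x))\<^sup>2) \<partial>M)"
      by (auto simp: N_def intro!: Bochner_Integration.integral_nonneg sum_nonneg)
    show ?thesis
    proof (intro conjI ballI)
      show "(\<lambda>n::int. (cmod (L2_inner f (shift (of_int n * t) (\<phi> j))))\<^sup>2) summable_on UNIV" if "j \<in> {1..L}" for j
      proof -
        obtain i where i: "j = Suc i" "i < L" using \<open>j \<in> {1..L}\<close> by (cases j) auto
        show ?thesis unfolding i(1) by (rule has_sum_imp_summable[OF hs[OF i(2)]])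
      qed
      have "(\<integral>x. N x \<partial>M) \<le> (K + 1) * (\<integral>x. (\<Sum>j<L. (cmod (?F j x))\<^sup>2) \<partial>M)"
        using S_ge pos by (simp add: distrib_right)
      then show "A * (L2_norm f)\<^sup>2 \<le> (\<Sum>j=1..L. \<Sum>\<^sub>\<infinity>n::int. (cmod (L2_inner f (shift (of_int n * t) (\<phi> j))))\<^sup>2)"
        unfolding sum_eq norm A_def using p K0 by (simp add: pos_divide_le_eq mult_ac mult_left_mono)
      have "(\<integral>x. (\<Sum>j<L. (cmod (?F j x))\<^sup>2) \<partial>M) \<le> (K + 1) * (\<integral>x. N x \<partial>M)"
        using S_le pos by (simp add: distrib_right)
      then show "(\<Sum>j=1..L. \<Sum>\<^sub>\<infinity>n::int. (cmod (L2_inner f (shift (of_int n * t) (\<phi> j))))\<^sup>2) \<le> B * (L2_norm f)\<^sup>2"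
        unfolding sum_eq norm B_def using p K0 by (simp add: mult.assoc mult_left_mono)
    qed
  qed
  ultimately show ?thesis
    unfolding is_frame_def using translate_band_limited by blast
qed


section \<open>The Riesz basis at critical density\<close>
definition partial_sum :: "(nat \<Rightarrow> int \<Rightarrow> complex) \<Rightarrow> int set \<Rightarrow> real \<Rightarrow> complex" where
  "partial_sum c N x = (\<Sum>j=1..L. \<Sum>n\<in>N. c j n * shift (of_int n * t) (\<phi> j) x)"

definition partial_symbol :: "(nat \<Rightarrow> int \<Rightarrow> complex) \<Rightarrow> int set \<Rightarrow> real \<Rightarrow> complex" where
  "partial_symbol c N \<xi> = indicator {-\<omega>..\<omega>} \<xi> * (\<Sum>j<L. (\<i> * complex_of_real \<xi>) ^ j * (\<Sum>n\<in>N. c (Suc j) n * mode t n \<xi>))"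

definition energy :: "(nat \<Rightarrow> int \<Rightarrow> complex) \<Rightarrow> int set \<Rightarrow> real" where
  "energy c N = (\<Sum>j=1..L. \<Sum>n\<in>N. (cmod (c j n))\<^sup>2)"

lemma has_fourier_partial_sum: "has_fourier (partial_sum c N) (partial_symbol c N)"
proof -
  have "has_fourier (\<lambda>x. \<Sum>j<L. 1 * (\<Sum>n\<in>N. c (Suc j) n * shift (of_int n * t) (\<phi> (Suc j)) x))
     (\<lambda>\<xi>. \<Sum>j<L. 1 * (\<Sum>n\<in>N. c (Suc j) n * (mode t n \<xi> * ((\<i> * complex_of_real \<xi>) ^ j * indicator {-\<omega>..\<omega>} \<xi>))))"
    by (intro has_fourier_sum has_fourier_translate) auto
  also have "(\<lambda>x. \<Sum>j<L. 1 * (\<Sum>n\<in>N. c (Suc j) n * shift (of_int n * t) (\<phi> (Suc j)) x)) = partial_sum c N"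
    by (rule ext) (simp only: partial_sum_def sum_from_1_eq_lessThan mult_1)
  also have "(\<lambda>\<xi>. \<Sum>j<L. 1 * (\<Sum>n\<in>N. c (Suc j) n * (mode t n \<xi> * ((\<i> * complex_of_real \<xi>) ^ j * indicator {-\<omega>..\<omega>} \<xi>))))
     = partial_symbol c N"
    by (simp add: partial_symbol_def fun_eq_iff sum_distrib_left mult_ac)
  finally show ?thesis .
qed

lemma partial_sum_L2: "partial_sum c N \<in> L2"
  using has_fourier_L2(1)[OF has_fourier_partial_sum] .

lemma borel_measurable_partial_sum [measurable]: "partial_sum c N \<in> borel_measurable borel"
  using partial_sum_L2[of c N] by (simp add: L2_iff)

lemma borel_measurable_partial_symbol [measurable]: "partial_symbol c N \<in> borel_measurable borel"
  using has_fourier_L2(2)[OF has_fourier_partial_sum[of c N]] by (simp add: L2_iff)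

lemma partial_sum_diff_coeffs:
  "partial_sum (\<lambda>j n. c j n - d j n) N x = partial_sum c N x - partial_sum d N x"
  by (simp add: partial_sum_def left_diff_distrib sum_subtractf)

lemma partial_sum_diff_sets:
  assumes "finite N" "N' \<subseteq> N"
  shows "partial_sum c N x - partial_sum c N' x = partial_sum c (N - N') x"
  using assms by (simp add: partial_sum_def sum_diff finite_subset sum_subtractf)

text \<open>At critical density the \<open>L\<close> periods starting at \<open>-\<omega>\<close> end exactly at \<open>\<omega>\<close>, so every
  point \<open>x + kp\<close> lies in the band and the indicator function disappears from the folded symbol.\<close>
lemma partial_sum_norm:
  fixes c :: "nat \<Rightarrow> int \<Rightarrow> complex"
  assumes tight: "t = real L * (pi / \<omega>)" and N: "finite N"
  defines "Q \<equiv> \<lambda>x. \<Sum>k<L. (cmod (\<Sum>j<L. node p x k ^ j * (\<Sum>n\<in>N. c (Suc j) n * mode t n x)))\<^sup>2"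
  shows "integrable M Q" "(LINT x|lborel. (cmod (partial_sum c N x))\<^sup>2) = (\<integral>x. Q x \<partial>M)"
proof -
  have end_point: "-\<omega> + real L * p = \<omega>"
  proof -
    have "t * \<omega> = real L * pi" using tight \<omega> by simp
    then show ?thesis using t by (simp add: p_def field_simps)
  qed
  define g where "g x = indicator {-\<omega>..<\<omega>} x * partial_symbol c N x" for x
  have [measurable]: "g \<in> borel_measurable borel" unfolding g_def[abs_def] by measurable
  have "AE x in lborel. partial_symbol c N x = g x"
    using AE_lborel_singleton[of \<omega>]
    by eventually_elim (auto simp: g_def partial_symbol_def indicator_def)
  then have fg: "has_fourier (partial_sum c N) g"
    by (intro has_fourier_cong_AE[OF has_fourier_partial_sum]) auto
  have g0: "g x = 0" if "x \<notin> {-\<omega>..<\<omega>}" for x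
    using that by (simp add: g_def)
  have QM: "(\<Sum>k<L. (cmod (g (x + real k * p)))\<^sup>2) = Q x" if "x \<in> space M" for x
    unfolding Q_def
  proof (intro sum.cong refl)
    fix k assume k: "k \<in> {..<L}"
    have x: "-\<omega> \<le> x" "x < -\<omega> + p" using that by (auto simp: space_restrict_space)
    have "real k * p + p \<le> real L * p"
      using k p mult_right_mono[of "real k + 1" "real L" p] by (simp add: algebra_simps)
    then have "x + real k * p < \<omega>" using x end_point by linarith
    moreover have "-\<omega> \<le> x + real k * p" using x p by (simp add: add_increasing2)
    ultimately have "g (x + real k * p) = (\<Sum>j<L. node p x k ^ j * (\<Sum>n\<in>N. c (Suc j) n * mode t n x))"
      unfolding g_def partial_symbol_def mode_shift_p node_def by simp
    then show "(cmod (g (x + real k * p)))\<^sup>2 = (cmod (\<Sum>j<L. node p x k ^ j * (\<Sum>n\<in>N. c (Suc j) n * mode t n x)))\<^sup>2"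
      by simp
  qed
  note fold = spectrum_norm[OF has_fourier_L2(2)[OF fg] g0]
  have "integrable M (\<lambda>x. \<Sum>k<L. (cmod (g (x + real k * p)))\<^sup>2) \<longleftrightarrow> integrable M Q"
    using QM by (intro Bochner_Integration.integrable_cong) auto
  then show "integrable M Q" using fold(1) by simp
  have "(LINT x|lborel. (cmod (partial_sum c N x))\<^sup>2) = (\<integral>x. (\<Sum>k<L. (cmod (g (x + real k * p)))\<^sup>2) \<partial>M)"
    using has_fourier_norm[OF fg] fold(2) by simp
  also have "\<dots> = (\<integral>x. Q x \<partial>M)"
    using QM by (intro Bochner_Integration.integral_cong) auto
  finally show "(LINT x|lborel. (cmod (partial_sum c N x))\<^sup>2) = (\<integral>x. Q x \<partial>M)" .
qed

text \<open>The transposed Vandermonde matrix is applied pointwise to the trigonometric polynomials with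
  coefficients \<open>c\<^sub>j\<close>, whose square norms over a period are \<open>p \<Sum>\<^sub>n |c\<^sub>j(n)|\<^sup>2\<close>.\<close>
lemma riesz_bounds:
  assumes tight: "t = real L * (pi / \<omega>)"
  obtains K where "K > 0"
    "\<And>c N. finite N \<Longrightarrow> sq_norm lborel (partial_sum c N) \<le> ennreal (K * energy c N)"
    "\<And>c N. finite N \<Longrightarrow> ennreal (energy c N) \<le> ennreal K * sq_norm lborel (partial_sum c N)"
proof -
  obtain K where K0: "K \<ge> 0"
    and upper: "\<And>x E. x \<in> {-\<omega>..-\<omega> + p} \<Longrightarrow>
      (\<Sum>k<L. (cmod (\<Sum>j<L. node p x k ^ j * E j))\<^sup>2) \<le> K * (\<Sum>j<L. (cmod (E j))\<^sup>2)"
    and lower: "\<And>x E. x \<in> {-\<omega>..-\<omega> + p} \<Longrightarrow>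
      (\<Sum>j<L. (cmod (E j))\<^sup>2) \<le> K * (\<Sum>k<L. (cmod (\<Sum>j<L. node p x k ^ j * E j))\<^sup>2)"
    by (rule vandermonde_bounds[OF p(3), of "-\<omega>" "-\<omega> + p" L]) (rule that)
  have bounds: "(LINT x|lborel. (cmod (partial_sum c N x))\<^sup>2) \<le> K * (p * energy c N)"
      "p * energy c N \<le> K * (LINT x|lborel. (cmod (partial_sum c N x))\<^sup>2)"
    if N: "finite N" for c N
  proof -
    define E where "E j x = (\<Sum>n\<in>N. c (Suc j) n * mode t n x)" for j x
    define Q where "Q x = (\<Sum>k<L. (cmod (\<Sum>j<L. node p x k ^ j * E j x))\<^sup>2)" for x
    have Q: "integrable M Q" "(LINT x|lborel. (cmod (partial_sum c N x))\<^sup>2) = (\<integral>x. Q x \<partial>M)"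
      using partial_sum_norm[OF tight N, of c] unfolding Q_def E_def by auto
    have [measurable]: "E j \<in> borel_measurable borel" for j
      unfolding E_def[abs_def] by measurable
    have intE: "integrable M (\<lambda>x. (cmod (E j x))\<^sup>2)" for j
    proof -
      interpret finite_measure M unfolding M_period by (rule finite_measure_period)
      show ?thesis
      proof (rule integrable_const_bound[where B = "(\<Sum>n\<in>N. cmod (c (Suc j) n))\<^sup>2"])
        have "cmod (E j x) \<le> (\<Sum>n\<in>N. cmod (c (Suc j) n))" for x
          unfolding E_def by (rule order_trans[OF norm_sum]) (simp add: norm_mult)
        then show "AE x in M. norm ((cmod (E j x))\<^sup>2) \<le> (\<Sum>n\<in>N. cmod (c (Suc j) n))\<^sup>2"
          by (intro AE_I2) (simp add: power_mono)
      qed (rule measurable_restrict_space1, simp)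
    qed
    have "(\<integral>x. (\<Sum>j<L. (cmod (E j x))\<^sup>2) \<partial>M) = (\<Sum>j<L. (\<integral>x. (cmod (E j x))\<^sup>2 \<partial>M))"
      using intE by (intro Bochner_Integration.integral_sum)
    also have "\<dots> = (\<Sum>j<L. p * (\<Sum>n\<in>N. (cmod (c (Suc j) n))\<^sup>2))"
      unfolding E_def p_def by (simp only: integral_trig_poly_norm[OF t N])
    also have "\<dots> = p * energy c N"
      unfolding energy_def sum_from_1_eq_lessThan by (simp add: sum_distrib_left)
    finally have E: "(\<integral>x. (\<Sum>j<L. (cmod (E j x))\<^sup>2) \<partial>M) = p * energy c N" .
    have intS: "integrable M (\<lambda>x. \<Sum>j<L. (cmod (E j x))\<^sup>2)" using intE by auto
    have Q_upper: "Q x \<le> K * (\<Sum>j<L. (cmod (E j x))\<^sup>2)" and Q_lower: "(\<Sum>j<L. (cmod (E j x))\<^sup>2) \<le> K * Q x"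
      if "x \<in> space M" for x
      using that upper[of x "\<lambda>j. E j x"] lower[of x "\<lambda>j. E j x"] by (auto simp: Q_def space_restrict_space)
    have "(\<integral>x. Q x \<partial>M) \<le> (\<integral>x. K * (\<Sum>j<L. (cmod (E j x))\<^sup>2) \<partial>M)"
      using Q(1) intS Q_upper by (intro integral_mono) auto
    then show "(LINT x|lborel. (cmod (partial_sum c N x))\<^sup>2) \<le> K * (p * energy c N)"
      by (simp only: Q(2) E integral_mult_right_zero)
    have "(\<integral>x. (\<Sum>j<L. (cmod (E j x))\<^sup>2) \<partial>M) \<le> (\<integral>x. K * Q x \<partial>M)"
      using Q(1) intS Q_lower by (intro integral_mono) auto
    then show "p * energy c N \<le> K * (LINT x|lborel. (cmod (partial_sum c N x))\<^sup>2)"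
      by (simp only: Q(2) E integral_mult_right_zero)
  qed
  have sq_norm: "sq_norm lborel (partial_sum c N) = ennreal (LINT x|lborel. (cmod (partial_sum c N x))\<^sup>2)" for c N
    using partial_sum_L2[of c N] by (intro sq_norm_integrable(2)) (auto simp: L2_iff)
  have e0: "energy c N \<ge> 0" for c N by (auto simp: energy_def intro!: sum_nonneg)
  \<comment> \<open>One constant that dominates the factors \<open>K * p\<close> and \<open>K / p\<close> of the two bounds.\<close>
  define K' where "K' = K * p + K / p + 1"
  have K': "K' > 0" "K * p \<le> K'" "K / p \<le> K'"
    using K0 p by (auto simp: K'_def add_nonneg_pos)
  show ?thesis
  proof (rule that[OF K'(1)])
    fix c :: "nat \<Rightarrow> int \<Rightarrow> complex" and N :: "int set" assume N: "finite N"
    have "(LINT x|lborel. (cmod (partial_sum c N x))\<^sup>2) \<le> K * p * energy c N"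
      using bounds(1)[OF N, of c] by (simp add: mult_ac)
    also have "\<dots> \<le> K' * energy c N" using K' e0 by (intro mult_right_mono) auto
    finally show "sq_norm lborel (partial_sum c N) \<le> ennreal (K' * energy c N)"
      unfolding sq_norm by (rule ennreal_leI)
    have "energy c N \<le> K / p * (LINT x|lborel. (cmod (partial_sum c N x))\<^sup>2)"
      using bounds(2)[OF N, of c] p by (simp add: field_simps)
    also have "\<dots> \<le> K' * (LINT x|lborel. (cmod (partial_sum c N x))\<^sup>2)"
      using K' by (intro mult_right_mono) auto
    finally show "ennreal (energy c N) \<le> ennreal K' * sq_norm lborel (partial_sum c N)"
      unfolding sq_norm using K' by (subst ennreal_mult[symmetric]) (auto intro: ennreal_leI)
  qed
qed

lemma synthesis_iff:
  "synthesis \<omega> L \<phi> t c f \<longleftrightarrow> f \<in> band_limited \<omega> \<and>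
     ((\<lambda>N. sq_norm lborel (\<lambda>x. partial_sum c N x - f x)) \<longlongrightarrow> 0) (finite_subsets_at_top UNIV)"
  by (simp add: synthesis_def L2_tendsto_sq_norm partial_sum_def)

text \<open>If two coefficient families represent \<open>f\<close>, the partial sums of their difference tend to 0,
  while each single coefficient of the difference is dominated by the norm of every partial sum that
  contains it.\<close>
lemma synthesis_injective:
  assumes tight: "t = real L * (pi / \<omega>)"
    and c: "synthesis \<omega> L \<phi> t c f" and d: "synthesis \<omega> L \<phi> t d f" and j: "j \<in> {1..L}"
  shows "c j = d j"
proof
  fix n
  obtain K where K: "K > 0"
    and lower: "\<And>c N. finite N \<Longrightarrow> ennreal (energy c N) \<le> ennreal K * sq_norm lborel (partial_sum c N)"
    by (rule riesz_bounds[OF tight]) (rule that)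
  have [measurable]: "f \<in> borel_measurable borel"
    using c by (auto simp: synthesis_iff band_limited_def L2_iff)
  let ?F = "finite_subsets_at_top (UNIV :: int set)"
  let ?D = "\<lambda>N. ennreal K * (2 * sq_norm lborel (\<lambda>x. partial_sum c N x - f x) + 2 * sq_norm lborel (\<lambda>x. partial_sum d N x - f x))"
  have "ennreal ((cmod (c j n - d j n))\<^sup>2) \<le> ?D N" if N: "finite N" "n \<in> N" for N
  proof -
    let ?e = "\<lambda>j n. c j n - d j n"
    have "(cmod (?e j n))\<^sup>2 \<le> (\<Sum>n\<in>N. (cmod (?e j n))\<^sup>2)"
      using N by (intro member_le_sum[of n N "\<lambda>n. (cmod (?e j n))\<^sup>2"]) auto
    also have "\<dots> \<le> energy ?e N"
      unfolding energy_def using j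
      by (intro member_le_sum[of j "{1..L}" "\<lambda>j. \<Sum>n\<in>N. (cmod (?e j n))\<^sup>2"]) (auto intro: sum_nonneg)
    finally have "ennreal ((cmod (?e j n))\<^sup>2) \<le> ennreal (energy ?e N)" by (rule ennreal_leI)
    also have "\<dots> \<le> ennreal K * sq_norm lborel (partial_sum ?e N)" by (rule lower[OF N(1)])
    also have "sq_norm lborel (partial_sum ?e N) = sq_norm lborel (\<lambda>x. partial_sum c N x - partial_sum d N x)"
      by (simp add: partial_sum_diff_coeffs[abs_def])
    also have "ennreal K * \<dots> \<le> ennreal K * (2 * sq_norm lborel (\<lambda>x. partial_sum c N x - f x) + 2 * sq_norm lborel (\<lambda>x. f x - partial_sum d N x))"
      by (intro mult_left_mono sq_norm_diff_le) auto
    also have "sq_norm lborel (\<lambda>x. f x - partial_sum d N x) = sq_norm lborel (\<lambda>x. partial_sum d N x - f x)"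
      by (rule sq_norm_minus_commute)
    finally show ?thesis .
  qed
  then have "\<forall>\<^sub>F N in ?F. ennreal ((cmod (c j n - d j n))\<^sup>2) \<le> ?D N"
    unfolding eventually_finite_subsets_at_top by (intro exI[of _ "{n}"]) auto
  moreover have "(?D \<longlongrightarrow> ennreal K * (2 * 0 + 2 * 0)) ?F"
    using c d unfolding synthesis_iff by (intro tendsto_add ennreal_tendsto_cmult) auto
  ultimately have "ennreal ((cmod (c j n - d j n))\<^sup>2) \<le> ennreal K * (2 * 0 + 2 * 0)"
    by (intro tendsto_lowerbound[of ?D _ ?F]) auto
  then show "c j n = d j n" by simp
qed

lemma energy_tail:
  assumes c: "c \<in> ell2 L" and e: "e > 0"
  obtains N0 where "finite N0" "\<And>N. finite N \<Longrightarrow> N \<inter> N0 = {} \<Longrightarrow> energy c N \<le> e"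
proof -
  define q where "q n = (\<Sum>j=1..L. (cmod (c j n))\<^sup>2)" for n
  have energy: "energy c N = sum q N" for N
    unfolding energy_def q_def by (rule sum.swap)
  have "q summable_on UNIV"
  proof -
    have "(\<lambda>n. \<Sum>j\<in>J. (cmod (c j n))\<^sup>2) summable_on UNIV" if "finite J" "J \<subseteq> {1..L}" for J
      using that c by (induction J) (auto simp: ell2_def intro!: summable_on_add)
    then show ?thesis unfolding q_def by blast
  qed
  then have "(sum q \<longlongrightarrow> infsum q UNIV) (finite_subsets_at_top UNIV)"
    using has_sum_infsum unfolding has_sum_def by blast
  then have "\<forall>\<^sub>F N in finite_subsets_at_top UNIV. dist (sum q N) (infsum q UNIV) < e"
    using e by (rule tendstoD)
  then obtain N0 where N0: "finite N0" "\<And>N. finite N \<Longrightarrow> N0 \<subseteq> N \<Longrightarrow> dist (sum q N) (infsum q UNIV) < e"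
    unfolding eventually_finite_subsets_at_top by auto
  show ?thesis
  proof (rule that[OF N0(1)])
    fix N assume N: "finite N" "N \<inter> N0 = {}"
    have "sum q (N \<union> N0) \<le> infsum q UNIV"
      using \<open>q summable_on UNIV\<close> N(1) N0(1)
      by (intro finite_sum_le_infsum) (auto simp: q_def intro: sum_nonneg)
    moreover have "sum q (N \<union> N0) = sum q N + sum q N0"
      using N N0(1) by (intro sum.union_disjoint)
    moreover have "infsum q UNIV - sum q N0 < e"
      using N0(2)[OF N0(1)] by (simp add: dist_real_def)
    ultimately show "energy c N \<le> e" unfolding energy by linarith
  qed
qed

text \<open>The sums over \<open>{-n..n}\<close> and their symbols are Cauchy by the upper Riesz bound; the two
  limits form a Fourier pair because \<open>has_fourier\<close> is closed. The tail estimate holds for all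
  finite index sets, so convergence extends from these windows to arbitrary finite sets.\<close>
lemma synthesis_exists:
  assumes tight: "t = real L * (pi / \<omega>)" and c: "c \<in> ell2 L"
  shows "\<exists>f. synthesis \<omega> L \<phi> t c f"
proof -
  obtain K where K: "K > 0"
    and upper: "\<And>c N. finite N \<Longrightarrow> sq_norm lborel (partial_sum c N) \<le> ennreal (K * energy c N)"
    by (rule riesz_bounds[OF tight]) (rule that)
  define W where "W n = {- int n..int n}" for n
  have tail: "\<exists>n0. \<forall>N N'. finite N \<longrightarrow> W n0 \<subseteq> N' \<longrightarrow> N' \<subseteq> N \<longrightarrow>
      sq_norm lborel (\<lambda>x. partial_sum c N x - partial_sum c N' x) \<le> ennreal e" if "e > 0" for e
  proof -
    have "e / K > 0" using \<open>e > 0\<close> K by simp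
    obtain N0 where N0: "finite N0" "\<And>N. finite N \<Longrightarrow> N \<inter> N0 = {} \<Longrightarrow> energy c N \<le> e / K"
      by (rule energy_tail[OF c \<open>e / K > 0\<close>]) (rule that)
    define n0 where "n0 = nat (Max (insert 0 (abs ` N0)))"
    have "n \<in> W n0" if "n \<in> N0" for n
    proof -
      have "\<bar>n\<bar> \<le> Max (insert 0 (abs ` N0))" using that N0(1) by (intro Max_ge) auto
      moreover have "0 \<le> Max (insert 0 (abs ` N0))" using N0(1) by (intro Max_ge) auto
      ultimately have "\<bar>n\<bar> \<le> int n0" by (simp add: n0_def)
      then show ?thesis unfolding W_def by auto
    qed
    then have sub: "N0 \<subseteq> W n0" by blast
    show ?thesis
    proof (intro exI[of _ n0] allI impI)
      fix N N' assume N: "finite N" "W n0 \<subseteq> N'" "N' \<subseteq> N"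
      have "sq_norm lborel (\<lambda>x. partial_sum c N x - partial_sum c N' x) = sq_norm lborel (partial_sum c (N - N'))"
        using partial_sum_diff_sets[OF N(1,3)] by simp
      also have "\<dots> \<le> ennreal (K * energy c (N - N'))" using N by (intro upper) auto
      also have "K * energy c (N - N') \<le> K * (e / K)"
        using N sub K by (intro mult_left_mono N0(2)) auto
      finally show "sq_norm lborel (\<lambda>x. partial_sum c N x - partial_sum c N' x) \<le> ennreal e"
        using K by (simp add: ennreal_leI)
    qed
  qed
  have Cauchy: "\<exists>n0. \<forall>m\<ge>n0. \<forall>n\<ge>n0. sq_norm lborel (\<lambda>x. partial_sum c (W m) x - partial_sum c (W n) x) \<le> ennreal e"
    if "e > 0" for e
  proof -
    obtain n0 where n0: "\<And>N N'. finite N \<Longrightarrow> W n0 \<subseteq> N' \<Longrightarrow> N' \<subseteq> N \<Longrightarrow>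
      sq_norm lborel (\<lambda>x. partial_sum c N x - partial_sum c N' x) \<le> ennreal e"
      using tail[OF \<open>e > 0\<close>] by blast
    have mono: "W m \<subseteq> W n" if "m \<le> n" for m n using that by (auto simp: W_def)
    have fin: "finite (W n)" for n by (simp add: W_def)
    show ?thesis
    proof (intro exI[of _ n0] allI impI)
      fix m n assume "m \<ge> n0" "n \<ge> n0"
      show "sq_norm lborel (\<lambda>x. partial_sum c (W m) x - partial_sum c (W n) x) \<le> ennreal e"
      proof (cases "n \<le> m")
        case True
        then show ?thesis using \<open>n \<ge> n0\<close> by (intro n0 fin mono)
      next
        case False
        then have "sq_norm lborel (\<lambda>x. partial_sum c (W n) x - partial_sum c (W m) x) \<le> ennreal e"
          using \<open>m \<ge> n0\<close> by (intro n0 fin mono) auto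
        then show ?thesis by (subst sq_norm_minus_commute)
      qed
    qed
  qed
  have symbol_diff: "sq_norm lborel (\<lambda>x. partial_symbol c (W m) x - partial_symbol c (W n) x)
      = sq_norm lborel (\<lambda>x. partial_sum c (W m) x - partial_sum c (W n) x)" for m n
    using has_fourier_isometry[OF has_fourier_add_cmult[OF has_fourier_partial_sum has_fourier_partial_sum],
        of c "W m" "-1" c "W n"] by simp
  have L2_limit: "h \<in> L2"
    if "\<And>n. u n \<in> L2" and h: "h \<in> borel_measurable lborel" and lim: "(\<lambda>n. sq_norm lborel (\<lambda>x. u n x - h x)) \<longlonglongrightarrow> 0"
    for u :: "nat \<Rightarrow> real \<Rightarrow> complex" and h
  proof -
    obtain n where "sq_norm lborel (\<lambda>x. u n x - h x) \<le> ennreal 1"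
      by (rule ex_approx_of_tendsto_0[OF lim, of 1]) auto
    then have "sq_norm lborel (\<lambda>x. u n x - h x) < \<infinity>" by (rule order.strict_trans1) simp
    then have "(\<lambda>x. u n x - h x) \<in> L2"
      using that(1)[of n] h by (auto simp: L2_iff)
    from L2_diff[OF that(1)[of n] this] show ?thesis by simp
  qed
  obtain f where f: "f \<in> borel_measurable lborel"
      "(\<lambda>n. sq_norm lborel (\<lambda>x. partial_sum c (W n) x - f x)) \<longlonglongrightarrow> 0"
    by (rule L2_complete[of "\<lambda>n. partial_sum c (W n)" lborel]) (use Cauchy in auto)
  obtain g where g: "g \<in> borel_measurable lborel"
      "(\<lambda>n. sq_norm lborel (\<lambda>x. partial_symbol c (W n) x - g x)) \<longlonglongrightarrow> 0"
    by (rule L2_complete[of "\<lambda>n. partial_symbol c (W n)" lborel]) (use Cauchy symbol_diff in auto)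
  \<comment> \<open>Restricting the limit to the band only brings it closer to the symbols, which vanish outside.\<close>
  define g' where "g' x = indicator {-\<omega>..\<omega>} x * g x" for x
  have [measurable]: "f \<in> borel_measurable borel" using f by simp
  have "g' \<in> borel_measurable lborel" using g(1) unfolding g'_def[abs_def] by measurable
  have "sq_norm lborel (\<lambda>x. partial_symbol c (W n) x - g' x) \<le> sq_norm lborel (\<lambda>x. partial_symbol c (W n) x - g x)" for n
    by (intro sq_norm_mono) (auto simp: g'_def partial_symbol_def indicator_def)
  then have g': "(\<lambda>n. sq_norm lborel (\<lambda>x. partial_symbol c (W n) x - g' x)) \<longlonglongrightarrow> 0"
    by (rule ennreal_tendsto_0_le) (rule g(2))
  have fL: "f \<in> L2" by (rule L2_limit[OF partial_sum_L2 f])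
  have gL: "g' \<in> L2" by (rule L2_limit[OF has_fourier_L2(2)[OF has_fourier_partial_sum] \<open>g' \<in> _\<close> g'])
  have "has_fourier f g'"
    by (rule has_fourier_closed[OF has_fourier_partial_sum fL gL f(2) g'])
  then have "f \<in> band_limited \<omega>"
    using fL unfolding band_limited_def by (auto intro!: exI[of _ g'] simp: g'_def)
  moreover have "((\<lambda>N. sq_norm lborel (\<lambda>x. partial_sum c N x - f x)) \<longlongrightarrow> 0) (finite_subsets_at_top UNIV)"
  proof (rule order_tendstoI)
    fix y :: ennreal assume "0 < y"
    then obtain z where z: "0 < z" "z < y" using dense[OF \<open>0 < y\<close>] by blast
    define e where "e = enn2real z"
    have "z < top" using z(2) by (rule order.strict_trans2) simp
    then have e: "e > 0" "ennreal e < y"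
      using z by (simp_all add: e_def enn2real_positive_iff)
    have "e / 4 > 0" using e by simp
    obtain n0 where n0: "\<And>N N'. finite N \<Longrightarrow> W n0 \<subseteq> N' \<Longrightarrow> N' \<subseteq> N \<Longrightarrow>
      sq_norm lborel (\<lambda>x. partial_sum c N x - partial_sum c N' x) \<le> ennreal (e / 4)"
      using tail[OF \<open>e / 4 > 0\<close>] by blast
    have "\<forall>\<^sub>F n in sequentially. sq_norm lborel (\<lambda>x. partial_sum c (W n) x - f x) < ennreal (e / 4)"
      using order_tendstoD(2)[OF f(2)] \<open>e / 4 > 0\<close> by simp
    then obtain n where n: "n \<ge> n0" "sq_norm lborel (\<lambda>x. partial_sum c (W n) x - f x) < ennreal (e / 4)"
      using eventually_happens'[OF _ eventually_conj[OF eventually_ge_at_top[of n0]]] by fastforce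
    have "sq_norm lborel (\<lambda>x. partial_sum c N x - f x) < y" if N: "finite N" "W n \<subseteq> N" for N
    proof -
      have "sq_norm lborel (\<lambda>x. partial_sum c N x - f x)
         \<le> 2 * sq_norm lborel (\<lambda>x. partial_sum c N x - partial_sum c (W n) x) + 2 * sq_norm lborel (\<lambda>x. partial_sum c (W n) x - f x)"
        by (rule sq_norm_diff_le) measurable
      also have "\<dots> \<le> 2 * ennreal (e / 4) + 2 * ennreal (e / 4)"
        using N n by (intro add_mono mult_left_mono n0) (auto simp: W_def)
      also have "\<dots> = ennreal e"
      proof -
        have double: "2 * ennreal y = ennreal (2 * y)" if "y \<ge> 0" for y
          using that by (simp add: ennreal_mult)
        show ?thesis using e by (simp add: double ennreal_plus[symmetric] del: ennreal_plus)
      qed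
      finally show ?thesis using e(2) by (rule order.strict_trans1)
    qed
    then show "\<forall>\<^sub>F N in finite_subsets_at_top UNIV. sq_norm lborel (\<lambda>x. partial_sum c N x - f x) < y"
      unfolding eventually_finite_subsets_at_top by (intro exI[of _ "W n"]) (auto simp: W_def)
  qed auto
  ultimately show ?thesis unfolding synthesis_iff by blast
qed

theorem riesz_basis:
  assumes "t = real L * (pi / \<omega>)"
  shows "is_riesz_basis \<omega> L \<phi> t"
  unfolding is_riesz_basis_def
  using frame synthesis_exists[OF assms] synthesis_injective[OF assms] by blast

end

theorem theorem4p2:
  fixes \<omega> t\<^sub>o :: real and L :: nat and \<phi> :: "nat \<Rightarrow> real \<Rightarrow> complex"
  assumes "\<omega> > 0"
    and "L > 1"
    and "\<And>j. j \<in> {1..L} \<Longrightarrow> \<phi> j \<in> L2"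
    and "\<And>j. j \<in> {1..L} \<Longrightarrow>
           has_fourier (\<phi> j)
             (\<lambda>x. (\<i> * complex_of_real x) ^ (j - 1) * indicator {-\<omega>..\<omega>} x)"
    and "t\<^sub>o > 0"
  shows "((real L - 1) * (pi / \<omega>) < t\<^sub>o \<and> t\<^sub>o \<le> real L * (pi / \<omega>) \<longrightarrow> is_frame \<omega> L \<phi> t\<^sub>o) \<and>
         (t\<^sub>o = real L * (pi / \<omega>) \<longrightarrow> is_riesz_basis \<omega> L \<phi> t\<^sub>o)"
proof -
  have "derivative_translates \<omega> t\<^sub>o L \<phi>" if "t\<^sub>o \<le> real L * (pi / \<omega>)"
    by unfold_locales (use assms that in auto)
  then show ?thesis
    using derivative_translates.frame derivative_translates.riesz_basis by blast
qed

end
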